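(* Let $\sigma>1$ and $\ell > \max(\pi/2, L(\sigma))$, where $L(\sigma):=\sum_p\arcsin(p^{-\sigma})$ (sum over primes). Then \[ d(\sigma)=1-\frac{\pi}{2\ell}-\frac{2}{\pi}\sum_{n=1}^\infty \frac{1}{n}\psi_\sigma\Bigl(\frac{\pi n}{\ell}\Bigr)\sin\Bigl(\frac{n\pi^2}{2\ell}\Bigr). \]
   Context: Let $G$ be $\mathbb{C}$ with cuts along $(-\infty+i\gamma,\beta+i\gamma]$ for each zero or pole $\beta+i\gamma$ of the Riemann zeta function $\zeta$ with $\beta\ge\frac12$; on $G$ let $\log\zeta$ be the branch real on $(1,\infty)$ and $\arg\zeta(s):=\Im\log\zeta(s)$. For $\sigma>\frac12$ define \[d(\sigma):=\lim_{T\to\infty}\frac{1}{2T}\bigl|\{t\in\mathbb{R}:|t|<T,\ |\arg\zeta(\sigma+it)|>\pi/2\}\bigr|\] (Lebesgue measure; the limit exists by Bohr–Jessen theory). Let $(z_p)_p$, $p$ ranging over primes, be independent random variables each uniformly distributed on the unit circle, $S:=-\sum_p\log(1-p^{-\sigma}z_p)$ (principal logarithm, convergent almost surely), and $\psi_\sigma(x):=\mathbb{E}[\exp(ix\,\Im S)]$ the characteristic function of $\Im S$. (By Bohr–Jessen, $d(\sigma)=1-\mathbb{P}(\Im S\in[-\pi/2,\pi/2])$.) *)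

theory Defs
  imports "HOL-Probability.Probability" "HOL-Complex_Analysis.Complex_Analysis"
begin

text \<open>
  The Riemann zeta function: the Dirichlet series where it converges absolutely, and its
  holomorphic extension to \<open>\<complex> - {1}\<close> (unique by the identity theorem) elsewhere. The value at
  the pole \<open>1\<close> is immaterial.
\<close>

definition zeta :: "complex \<Rightarrow> complex" where
  "zeta s =
     (if Re s > 1 then (\<Sum>n. 1 / of_nat (Suc n) powr s)
      else (SOME f. f holomorphic_on (- {1}) \<and>
              (\<forall>z. Re z > 1 \<longrightarrow> f z = (\<Sum>n. 1 / of_nat (Suc n) powr z))) s)"

definition cut_plane :: "complex set" where
  "cut_plane =
     - (\<Union>\<rho> \<in> {\<rho>. (zeta \<rho> = 0 \<or> is_pole zeta \<rho>) \<and> Re \<rho> \<ge> 1 / 2}.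
          {s. Im s = Im \<rho> \<and> Re s \<le> Re \<rho>})"

text \<open>
  Since \<open>cut_plane\<close> is connected and contains \<open>(1, \<infinity>)\<close>, any two functions with this property
  agree on \<open>cut_plane\<close>.
\<close>

definition is_log_zeta :: "(complex \<Rightarrow> complex) \<Rightarrow> bool" where
  "is_log_zeta log_zeta \<longleftrightarrow>
     log_zeta holomorphic_on cut_plane \<and>
     (\<forall>s \<in> cut_plane. exp (log_zeta s) = zeta s) \<and>
     (\<forall>x::real. x > 1 \<longrightarrow> log_zeta (of_real x) \<in> \<real>)"

definition arg_exceed_freq :: "(complex \<Rightarrow> complex) \<Rightarrow> real \<Rightarrow> real \<Rightarrow> real" where
  "arg_exceed_freq log_zeta \<sigma> T =
     1 / (2 * T) * measure lebesgue {t. \<bar>t\<bar> < T \<and> \<bar>Im (log_zeta (Complex \<sigma> t))\<bar> > pi / 2}"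

definition arg_exceed_density :: "(complex \<Rightarrow> complex) \<Rightarrow> real \<Rightarrow> real" where
  "arg_exceed_density log_zeta \<sigma> = Lim at_top (arg_exceed_freq log_zeta \<sigma>)"

definition uniform_circle :: "complex measure" where
  "uniform_circle = distr (uniform_measure lborel {0..<2 * pi}) borel cis"

text \<open>
  The sum over primes is taken in increasing order (for \<open>\<sigma> \<le> 1\<close> it need not converge
  absolutely).
\<close>

definition random_log_euler :: "(nat \<Rightarrow> 'a \<Rightarrow> complex) \<Rightarrow> real \<Rightarrow> 'a \<Rightarrow> complex" where
  "random_log_euler z \<sigma> \<omega> =
     - (\<Sum>p. if prime p then Ln (1 - of_real (real p powr (- \<sigma>)) * z p \<omega>) else 0)"

definition psi :: "'a measure \<Rightarrow> (nat \<Rightarrow> 'a \<Rightarrow> complex) \<Rightarrow> real \<Rightarrow> real \<Rightarrow> complex" where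
  "psi M z \<sigma> = char (distr M borel (\<lambda>\<omega>. Im (random_log_euler z \<sigma> \<omega>)))"

definition arcsin_prime_sum :: "real \<Rightarrow> real" where
  "arcsin_prime_sum \<sigma> = (\<Sum>\<^sub>\<infinity>p\<in>{p::nat. prime p}. arcsin (real p powr (- \<sigma>)))"

end

theory Submission
  imports Defs
begin

text \<open>
  For \<open>\<sigma> > 1\<close> the Euler product turns \<open>log \<zeta>(\<sigma> + it)\<close> into the random sum \<open>S\<close> with \<open>z p\<close> replaced by
  \<open>p^(-it)\<close>. The character \<open>(m/n)^(-it)\<close> has the same mean as its random counterpart, and the
  functions involved are uniform limits of linear combinations of such characters, so the
  characteristic function of \<open>arg \<zeta>(\<sigma> + it)\<close> for \<open>t\<close> uniform in \<open>[-T, T]\<close> tends to \<open>\<psi>\<close>. By Levy's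
  continuity theorem, and because \<open>Im S\<close> has no atoms, \<open>d(\<sigma>)\<close> is the probability that
  \<open>\<bar>Im S\<bar> > \<pi>/2\<close>. Since \<open>\<bar>Im S\<bar> \<le> L(\<sigma>) < l\<close>, one may insert \<open>Im S\<close> into the Fourier series of period
  \<open>2l\<close> of the indicator function of \<open>[-\<pi>/2, \<pi>/2]\<close>. Its partial sums are uniformly bounded, so the
  expectation can be taken term by term; \<open>\<psi>\<close> is real because \<open>arg \<zeta>\<close> is odd in \<open>t\<close>.
\<close>

section \<open>The sawtooth series\<close>

text \<open>The indicator function has jumps, so its Fourier series converges only conditionally,
  and not uniformly near them. This shapes both halves of the argument. On the analytic side,
  convergence is needed on the boundary of the unit disc: a sine times a cosine is a half-sum of two
  sawtooth terms, and the sawtooth series is the imaginary part of \<open>- Ln (1 - z)\<close> at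
  \<open>norm z = 1\<close>. On the probabilistic side, limits of means are accessible for uniform
  limits of linear combinations of characters, which exclude the indicator; hence the detour through
  characteristic functions and weak convergence.

  The sine factor comes from the Fourier coefficients: for period \<open>2 * l\<close> the indicator
  has mean \<open>pi / (2 * l)\<close> and cosine coefficients
  \<open>2 / (pi * n) * sin (n * pi^2 / (2 * l))\<close>, and \<open>d\<close> is the complementary
  probability. The condition \<open>l > pi / 2\<close> puts both jumps inside one period.

  No equidistribution theorem on the infinite torus is invoked: a deterministic function and its
  random counterpart are built in parallel from the same coefficients, and the limit of the means is
  carried along.\<close>

lemma one_minus_times_log_partial_sum:
  fixes w :: complex
  shows "(1 - w) * (\<Sum>k<Suc N. w ^ Suc k / of_nat (Suc k)) =
    w - w ^ Suc (Suc N) / of_nat (Suc N)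
      - (\<Sum>n<N. w ^ Suc (Suc n) / (of_nat (Suc n) * of_nat (Suc (Suc n))))"
proof (induction N)
  case 0
  then show ?case by (simp add: algebra_simps)
next
  case (Suc N)
  have ne: "complex_of_nat (Suc N) \<noteq> 0" "complex_of_nat (Suc (Suc N)) \<noteq> 0"
    by (simp_all del: of_nat_Suc)
  define v where "v = w ^ Suc (Suc N)"
  define a where "a = complex_of_nat (Suc N)"
  have a: "a \<noteq> 0" "a + 1 \<noteq> 0" "complex_of_nat (Suc (Suc N)) = a + 1"
    using ne by (simp_all add: a_def algebra_simps)
  have "(1 - w) * (\<Sum>k<Suc (Suc N). w ^ Suc k / of_nat (Suc k)) =
      (1 - w) * (\<Sum>k<Suc N. w ^ Suc k / of_nat (Suc k)) + (1 - w) * (v / (a + 1))"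
    by (subst sum.lessThan_Suc) (simp only: v_def a distrib_left)
  also have "\<dots> = w - v / a - (\<Sum>n<N. w ^ Suc (Suc n) / (of_nat (Suc n) * of_nat (Suc (Suc n))))
      + (1 - w) * (v / (a + 1))"
    by (subst Suc.IH) (simp only: v_def a_def)
  also have "\<dots> = w - w * v / (a + 1)
      - ((\<Sum>n<N. w ^ Suc (Suc n) / (of_nat (Suc n) * of_nat (Suc (Suc n)))) + v / (a * (a + 1)))"
  proof -
    \<comment> \<open>This is \<open>1 / (a + 1) = 1 / a - 1 / (a * (a + 1))\<close>: differences of
      consecutive coefficients decay quadratically, which is the gain from the factor
      \<open>1 - w\<close>.\<close>
    have "(1 - w) * (v / (a + 1)) = v / a - v / (a * (a + 1)) - w * v / (a + 1)"
      using a by (simp add: divide_simps) (simp add: algebra_simps)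
    then show ?thesis by simp
  qed
  also have "\<dots> = w - w ^ Suc (Suc (Suc N)) / of_nat (Suc (Suc N))
      - (\<Sum>n<Suc N. w ^ Suc (Suc n) / (of_nat (Suc n) * of_nat (Suc (Suc n))))"
    by (subst sum.lessThan_Suc) (simp only: v_def a power_Suc a_def [symmetric])
  finally show ?case .
qed

text \<open>
  Multiplied by \<open>1 - z\<close>, the logarithmic series becomes absolutely convergent on the closed disc,
  so the identity in the open disc extends to the boundary by continuity.
\<close>
lemma Ln_series_boundary:
  fixes z :: complex
  assumes z: "norm z = 1" "z \<noteq> 1"
  shows "(\<lambda>n. z ^ Suc n / of_nat (Suc n)) sums (- Ln (1 - z))"
proof -
  define g where "g n w = w ^ Suc (Suc n) / (of_nat (Suc n) * of_nat (Suc (Suc n)))"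
    for n and w :: complex
  define G where "G w = (\<Sum>n. g n w)" for w
  have maj: "norm (g n w) \<le> 1 / real (Suc n) ^ 2" if "norm w \<le> 1" for n w
  proof -
    have "norm (g n w) = norm w ^ Suc (Suc n) / (real (Suc n) * real (Suc (Suc n)))"
      unfolding g_def norm_divide norm_power norm_mult norm_of_nat ..
    also have "\<dots> \<le> 1 / (real (Suc n) * real (Suc n))"
      using that by (intro frac_le mult_left_mono power_le_one) auto
    finally show ?thesis by (simp add: power2_eq_square)
  qed
  have summ: "summable (\<lambda>n. 1 / real (Suc n) ^ 2)"
    using inverse_power_summable[of 2, where 'a = real]
    by (subst summable_Suc_iff) (simp add: field_simps)
  have ul: "uniform_limit (cball 0 1) (\<lambda>N w. \<Sum>n<N. g n w) G sequentially"
    unfolding G_def by (rule Weierstrass_m_test[OF _ summ]) (use maj in auto)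
  have contG: "continuous_on (cball 0 1) G"
    by (rule uniform_limit_theorem[OF _ ul])
       (auto simp: g_def simp del: of_nat_Suc power_Suc intro!: always_eventually continuous_intros)
  have lim: "(\<lambda>N. (1 - w) * (\<Sum>k<Suc N. w ^ Suc k / of_nat (Suc k))) \<longlonglongrightarrow> w - G w"
    if "norm w \<le> 1" for w
  proof -
    have "(\<lambda>N. \<Sum>n<N. g n w) \<longlonglongrightarrow> G w"
      using tendsto_uniform_limitI[OF ul, of w] that by simp
    moreover have "(\<lambda>N. w ^ Suc (Suc N) / of_nat (Suc N)) \<longlonglongrightarrow> 0"
    proof (rule Lim_null_comparison)
      show "\<forall>\<^sub>F N in sequentially. norm (w ^ Suc (Suc N) / of_nat (Suc N)) \<le> 1 / real (Suc N)"
        using that by (intro always_eventually allI)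
          (simp only: norm_divide norm_power norm_of_nat, intro divide_right_mono power_le_one, auto)
      show "(\<lambda>N. 1 / real (Suc N)) \<longlonglongrightarrow> 0"
        using LIMSEQ_inverse_real_of_nat by (simp add: inverse_eq_divide)
    qed
    ultimately have "(\<lambda>N. w - w ^ Suc (Suc N) / of_nat (Suc N) - (\<Sum>n<N. g n w)) \<longlonglongrightarrow> w - 0 - G w"
      by (intro tendsto_intros)
    then show ?thesis
      by (simp only: one_minus_times_log_partial_sum g_def diff_zero)
  qed
  have inner: "(1 - w) * - Ln (1 - w) = w - G w" if "norm w < 1" for w
  proof -
    have "(\<lambda>n. - ((w) ^ n) / of_nat n) sums Ln (1 - w)"
      using Ln_series'[of "- w"] that by simp
    from sums_minus[OF this] have "(\<lambda>n. w ^ n / of_nat n) sums - Ln (1 - w)" by simp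
    then have "(\<lambda>n. w ^ Suc n / of_nat (Suc n)) sums - Ln (1 - w)"
      by (subst sums_Suc_iff) simp
    then have "(\<lambda>N. \<Sum>k<Suc N. w ^ Suc k / of_nat (Suc k)) \<longlonglongrightarrow> - Ln (1 - w)"
      unfolding sums_def by (rule LIMSEQ_Suc)
    from tendsto_mult[OF tendsto_const[of "1 - w"] this] lim[of w] that
    show ?thesis by (intro LIMSEQ_unique[of _ "(1 - w) * - Ln (1 - w)"]) auto
  qed
  \<comment> \<open>The unit circle meets the line of real part 1 only at the point 1, so
    \<open>1 - z\<close> lies in the open right half-plane, away from the branch cut of
    \<open>Ln\<close>.\<close>
  have re: "Re (1 - z) > 0"
  proof -
    have "Re z \<noteq> 1"
    proof
      assume "Re z = 1"
      then have "Im z = 0" using z(1) by (simp add: cmod_def)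
      with \<open>Re z = 1\<close> z(2) show False by (simp add: complex_eq_iff)
    qed
    moreover have "Re z \<le> 1" using complex_Re_le_cmod[of z] z by simp
    ultimately show ?thesis by simp
  qed
  \<comment> \<open>Radii increasing to 1: \<open>inner\<close> holds at each
    \<open>r n * z\<close>, and both of its sides have a limit as the point moves radially to
    \<open>z\<close>.\<close>
  define r where "r n = 1 - 1 / real (Suc n)" for n
  have r: "0 \<le> r n" "r n < 1" for n by (auto simp: r_def)
  have r1: "(\<lambda>n. of_real (r n) * z) \<longlonglongrightarrow> of_real (1 - 0) * z"
    unfolding r_def using LIMSEQ_inverse_real_of_nat
    by (intro tendsto_intros) (simp add: inverse_eq_divide)
  have nr: "norm (of_real (r n) * z) < 1" for n
    using r[of n] z by (simp add: norm_mult)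
  have "(\<lambda>n. of_real (r n) * z - G (of_real (r n) * z)) \<longlonglongrightarrow> z - G z"
  proof (intro tendsto_diff)
    show "(\<lambda>n. of_real (r n) * z) \<longlonglongrightarrow> z" using r1 by simp
    show "(\<lambda>n. G (of_real (r n) * z)) \<longlonglongrightarrow> G z"
      by (rule continuous_on_tendsto_compose[OF contG])
         (use r1 nr z in \<open>auto intro!: always_eventually less_imp_le\<close>)
  qed
  moreover have "(\<lambda>n. (1 - of_real (r n) * z) * - Ln (1 - of_real (r n) * z))
      \<longlonglongrightarrow> (1 - z) * - Ln (1 - z)"
  proof -
    have "1 - z \<notin> \<real>\<^sub>\<le>\<^sub>0" using re by (auto simp: complex_nonpos_Reals_iff)
    then show ?thesis using r1 by (intro tendsto_intros) auto
  qed
  ultimately have eq: "(1 - z) * - Ln (1 - z) = z - G z"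
    using inner[OF nr] by (intro LIMSEQ_unique) auto
  have "(\<lambda>N. (1 - z) * (\<Sum>k<Suc N. z ^ Suc k / of_nat (Suc k)) / (1 - z)) \<longlonglongrightarrow> (z - G z) / (1 - z)"
    using lim[of z] z by (intro tendsto_divide tendsto_const) auto
  then have "(\<lambda>N. (\<Sum>k<Suc N. z ^ Suc k / of_nat (Suc k))) \<longlonglongrightarrow> - Ln (1 - z)"
    using z(2) by (simp add: eq [symmetric] del: sum.lessThan_Suc of_nat_Suc power_Suc)
  then show ?thesis
    unfolding sums_def by (rule LIMSEQ_imp_Suc)
qed

text \<open>Half-angle formulas give \<open>1 - cis y\<close> the polar form with modulus
  \<open>2 * sin (y / 2) > 0\<close> and angle \<open>(y - pi) / 2\<close>. That angle lies strictly
  between \<open>- pi / 2\<close> and \<open>pi / 2\<close>, so it is the principal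
  argument.\<close>

lemma Im_Ln_one_minus_cis:
  assumes "0 < y" "y < 2 * pi"
  shows "Im (Ln (1 - cis y)) = (y - pi) / 2"
proof -
  have s: "sin (y / 2) > 0" using assms by (intro sin_gt_zero) auto
  have "1 - cis y = of_real (2 * sin (y / 2)) * cis ((y - pi) / 2)"
  proof -
    have c: "cos ((y - pi) / 2) = sin (y / 2)" "sin ((y - pi) / 2) = - cos (y / 2)"
      by (simp_all add: diff_divide_distrib cos_diff sin_diff)
    have "cos y = 1 - 2 * sin (y / 2) ^ 2" "sin y = 2 * sin (y / 2) * cos (y / 2)"
      using cos_double_sin[of "y / 2"] sin_double[of "y / 2"] by simp_all
    then show ?thesis
      by (simp add: complex_eq_iff c power2_eq_square)
  qed
  also have "\<dots> = exp (of_real (ln (2 * sin (y / 2))) + \<i> * of_real ((y - pi) / 2))"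
    using s by (simp only: exp_add cis_conv_exp exp_of_real) (simp add: exp_of_real)
  finally have "Ln (1 - cis y) = of_real (ln (2 * sin (y / 2))) + \<i> * of_real ((y - pi) / 2)"
    using assms by (simp only:) (rule Ln_exp, auto)
  then show ?thesis by simp
qed

lemma sawtooth_sums:
  assumes "0 < y" "y < 2 * pi"
  shows "(\<lambda>n. sin (real (Suc n) * y) / real (Suc n)) sums ((pi - y) / 2)"
proof -
  have "cis y \<noteq> 1"
  proof
    assume "cis y = 1"
    then have "cos y = 1" by (simp add: complex_eq_iff)
    then show False using cos_double_sin[of "y / 2"] sin_gt_zero[of "y / 2"] assms by auto
  qed
  from sums_Im[OF Ln_series_boundary[OF _ this]]
  have "(\<lambda>n. Im (cis y ^ Suc n / of_nat (Suc n))) sums - Im (Ln (1 - cis y))" by simp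
  moreover have "Im (cis y ^ Suc n / of_nat (Suc n)) = sin (real (Suc n) * y) / real (Suc n)" for n
    by (simp only: Complex.DeMoivre Im_divide_of_nat cis.sel)
  moreover have "- ((y - pi) / 2) = (pi - y) / 2" by (simp add: field_simps)
  ultimately show ?thesis by (simp only: Im_Ln_one_minus_cis[OF assms])
qed

text \<open>Comparison with the Abel mean of radius \<open>1 - 1/N\<close>.\<close>
lemma sawtooth_partial_sums_bounded:
  "\<bar>\<Sum>n<N. sin (real (Suc n) * y) / real (Suc n)\<bar> \<le> pi + 2"
proof (cases "N = 0")
  case False
  \<comment> \<open>This radius balances the two errors: the first \<open>N\<close> terms change by
    at most \<open>1 / N\<close> each, and the tail is at most \<open>1 / N\<close> times a
    geometric series with sum \<open>N\<close>. Each error is thus at most 1.\<close>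
  define r where "r = 1 - 1 / real N"
  have r: "0 \<le> r" "r < 1" "1 - r = 1 / real N" using False by (auto simp: r_def field_simps)
  define b where "b n = sin (real (Suc n) * y) / real (Suc n)" for n
  define a where "a n = r ^ Suc n * b n" for n
  have b: "\<bar>b n\<bar> \<le> 1 / real (Suc n)" for n
    by (auto simp: b_def abs_divide simp del: of_nat_Suc intro: divide_right_mono)
  have nw: "norm (of_real r * cis y) < 1" using r by (simp add: norm_mult)
  have "(\<lambda>n. - ((of_real r * cis y) ^ n) / of_nat n) sums Ln (1 - of_real r * cis y)"
    using Ln_series'[of "- (of_real r * cis y)"] nw by simp
  from sums_Im[OF sums_minus[OF this]]
  have "(\<lambda>n. Im ((of_real r * cis y) ^ n / of_nat n)) sums - Im (Ln (1 - of_real r * cis y))" by simp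
  then have "(\<lambda>n. Im ((of_real r * cis y) ^ Suc n / of_nat (Suc n))) sums - Im (Ln (1 - of_real r * cis y))"
    by (subst sums_Suc_iff) simp
  moreover have "Im ((of_real r * cis y) ^ Suc n / of_nat (Suc n)) = a n" for n
    by (simp only: a_def b_def power_mult_distrib Complex.DeMoivre Im_divide_of_nat of_real_power [symmetric]
          Im_complex_of_real times_complex.sel cis.sel Re_complex_of_real) simp
  ultimately have sa: "a sums - Im (Ln (1 - of_real r * cis y))" by simp
  \<comment> \<open>The Abel mean is minus a principal argument, hence at most \<open>pi\<close> in
    absolute value, whatever \<open>r\<close> and \<open>y\<close> are. With the two errors this
    gives \<open>pi + 2\<close>.\<close>
  have "1 - of_real r * cis y \<noteq> 0" using nw by auto
  then have mean: "\<bar>suminf a\<bar> \<le> pi"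
    using mpi_less_Im_Ln[of "1 - of_real r * cis y"] Im_Ln_le_pi[of "1 - of_real r * cis y"]
    by (simp add: sums_unique[OF sa, symmetric])
  have geo: "(\<lambda>n. r ^ n) sums (1 / (1 - r))" using r by (intro geometric_sums) auto
  have tail: "\<bar>\<Sum>n. a (n + N)\<bar> \<le> 1"
  proof -
    have "\<bar>\<Sum>n. a (n + N)\<bar> \<le> (\<Sum>n. r ^ n * (1 / real N))"
    proof (rule norm_suminf_le[where 'a = real, simplified real_norm_def])
      show "summable (\<lambda>n. r ^ n * (1 / real N))"
        using geo by (intro summable_mult2) (auto simp: sums_iff)
      fix n
      have "r ^ Suc (n + N) \<le> r ^ n" using r by (intro power_decreasing) auto
      moreover have "\<bar>b (n + N)\<bar> \<le> 1 / real N"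
        by (rule order_trans[OF b]) (use False in \<open>auto intro!: divide_left_mono\<close>)
      ultimately show "\<bar>a (n + N)\<bar> \<le> r ^ n * (1 / real N)"
        using r unfolding a_def abs_mult by (intro mult_mono) auto
    qed
    also have "\<dots> = 1 / (1 - r) * (1 / real N)"
      by (rule sums_unique[symmetric], rule sums_mult2, rule geo)
    also have "\<dots> = 1" using r False by simp
    finally show ?thesis .
  qed
  \<comment> \<open>Bernoulli's inequality bounds \<open>1 - r ^ Suc n\<close> by
    \<open>Suc n / N\<close>, and the denominator of \<open>b n\<close> cancels the
    numerator.\<close>
  have head: "\<bar>\<Sum>n<N. b n - a n\<bar> \<le> 1"
  proof -
    have "\<bar>b n - a n\<bar> \<le> 1 / real N" for n
    proof -
      have "1 - r ^ Suc n \<le> real (Suc n) * (1 - r)"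
        using Bernoulli_inequality[of "r - 1" "Suc n"] r by (simp add: algebra_simps)
      moreover have "r ^ Suc n \<le> 1" using r by (intro power_le_one) auto
      moreover have "b n - a n = (1 - r ^ Suc n) * b n" by (simp add: a_def algebra_simps)
      ultimately have "\<bar>b n - a n\<bar> \<le> (real (Suc n) * (1 - r)) * (1 / real (Suc n))"
        using b[of n] by (simp only: abs_mult) (intro mult_mono, auto)
      also have "\<dots> = 1 / real N" by (simp add: r)
      finally show ?thesis .
    qed
    then have "(\<Sum>n<N. \<bar>b n - a n\<bar>) \<le> (\<Sum>n<N. 1 / real N)" by (intro sum_mono)
    then have "(\<Sum>n<N. \<bar>b n - a n\<bar>) \<le> 1" using False by simp
    then show ?thesis by (rule order_trans[OF sum_abs])
  qed
  have "(\<Sum>n<N. b n) = (\<Sum>n<N. b n - a n) + suminf a - (\<Sum>n. a (n + N))"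
    using suminf_split_initial_segment[of a N] sa by (simp add: sums_iff sum_subtractf)
  then show ?thesis using mean tail head unfolding b_def by linarith
qed auto

section \<open>Fourier series of the indicator function of the interval\<close>

lemma cos_times_sin_term:
  fixes N l x :: real
  shows "1 / N * cos (pi * N / l * x) * sin (N * pi\<^sup>2 / (2 * l)) =
    1 / 2 * (sin (N * (pi / l * (pi / 2) + pi / l * x)) / N)
    + 1 / 2 * (sin (N * (pi / l * (pi / 2) - pi / l * x)) / N)"
proof -
  have "N * pi\<^sup>2 / (2 * l) = N * (pi / l * (pi / 2))" "pi * N / l * x = N * (pi / l * x)"
    by (simp_all add: power2_eq_square)
  then show ?thesis
    by (simp only: distrib_left right_diff_distrib sin_add sin_diff)
      (simp add: add_divide_distrib diff_divide_distrib)
qed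

text \<open>Two sawtooths at the phases \<open>\<alpha> + \<beta>\<close> and
  \<open>\<alpha> - \<beta>\<close> are added. Their slopes in \<open>x\<close> cancel, which leaves
  a step function with the values \<open>(pi - \<alpha>) / 2\<close> and
  \<open>- \<alpha> / 2\<close>. The jumps are excluded because the series converges to the midpoint
  there.\<close>

lemma indicator_fourier_sums:
  assumes l: "l > pi / 2" and x: "\<bar>x\<bar> < l" "\<bar>x\<bar> \<noteq> pi / 2"
  shows "(\<lambda>n. 1 / real (Suc n) * cos (pi * real (Suc n) / l * x) * sin (real (Suc n) * pi\<^sup>2 / (2 * l)))
     sums (pi / 2 * (of_bool (\<bar>x\<bar> \<le> pi / 2) - pi / (2 * l)))"
proof -
  have l0: "l > 0" using l pi_gt_zero by linarith
  have main: "(\<lambda>n. 1 / real (Suc n) * cos (pi * real (Suc n) / l * x) * sin (real (Suc n) * pi\<^sup>2 / (2 * l)))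
     sums (pi / 2 * (of_bool (x \<le> pi / 2) - pi / (2 * l)))"
    if x: "0 \<le> x" "x < l" "x \<noteq> pi / 2" for x
  proof -
    define \<alpha> where "\<alpha> = pi / l * (pi / 2)"
    define \<beta> where "\<beta> = pi / l * x"
    \<comment> \<open>\<open>l > pi / 2\<close> amounts to \<open>\<alpha> < pi\<close>, and
      \<open>x < l\<close> to \<open>\<beta> < pi\<close>. So \<open>\<alpha> + \<beta>\<close> and,
      off the jump, \<open>\<bar>\<alpha> - \<beta>\<bar>\<close> lie strictly between 0 and
      \<open>2 * pi\<close>, where the sawtooth is linear.\<close>
    have ab: "0 < \<alpha>" "\<alpha> < pi" "0 \<le> \<beta>" "\<beta> < pi"
      using l0 l x by (auto simp: \<alpha>_def \<beta>_def field_simps)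
    have lt: "x < pi / 2 \<longleftrightarrow> \<beta> < \<alpha>" "\<alpha> \<noteq> \<beta>"
      using l0 x by (auto simp: \<alpha>_def \<beta>_def field_simps)
    have 1: "(\<lambda>n. sin (real (Suc n) * (\<alpha> + \<beta>)) / real (Suc n)) sums ((pi - (\<alpha> + \<beta>)) / 2)"
      using ab by (intro sawtooth_sums) auto
    have 2: "(\<lambda>n. sin (real (Suc n) * (\<alpha> - \<beta>)) / real (Suc n)) sums
         (if \<beta> < \<alpha> then (pi - (\<alpha> - \<beta>)) / 2 else - ((pi - (\<beta> - \<alpha>)) / 2))"
    proof (cases "\<beta> < \<alpha>")
      case True
      then show ?thesis using ab sawtooth_sums[of "\<alpha> - \<beta>"] by auto
    next
      case False
      have "sin (real (Suc n) * (\<alpha> - \<beta>)) = - sin (real (Suc n) * (\<beta> - \<alpha>))" for n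
        by (subst sin_minus [symmetric]) (simp add: algebra_simps)
      then show ?thesis
        using False lt ab sums_minus[OF sawtooth_sums[of "\<beta> - \<alpha>"]] by (simp del: of_nat_Suc)
    qed
    have val: "1 / 2 * ((pi - (\<alpha> + \<beta>)) / 2 + (if \<beta> < \<alpha> then (pi - (\<alpha> - \<beta>)) / 2 else - ((pi - (\<beta> - \<alpha>)) / 2)))
       = pi / 2 * (of_bool (x \<le> pi / 2) - pi / (2 * l))"
    proof -
      have "(x \<le> pi / 2) = (\<beta> < \<alpha>)" using lt x by auto
      moreover have "pi / (2 * l) = \<alpha> / pi" by (simp add: \<alpha>_def)
      ultimately show ?thesis by (auto simp: field_simps)
    qed
    show ?thesis
      unfolding cos_times_sin_term val [symmetric] \<alpha>_def [symmetric] \<beta>_def [symmetric]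
        distrib_left [of "1 / 2"]
      by (intro sums_mult sums_add 1 2)
  qed
  have "cos (pi * real (Suc n) / l * \<bar>x\<bar>) = cos (pi * real (Suc n) / l * x)" for n
    by (cases "x \<ge> 0") (auto simp del: of_nat_Suc)
  then show ?thesis using main[of "\<bar>x\<bar>"] x by (simp del: of_nat_Suc)
qed

lemma indicator_fourier_partial_sums_bounded:
  "\<bar>\<Sum>n<N. 1 / real (Suc n) * cos (pi * real (Suc n) / l * x) * sin (real (Suc n) * pi\<^sup>2 / (2 * l))\<bar> \<le> pi + 2"
  unfolding cos_times_sin_term sum.distrib sum_distrib_left [symmetric]
  using sawtooth_partial_sums_bounded[where N = N and y = "pi / l * (pi / 2) + pi / l * x"]
    sawtooth_partial_sums_bounded[where N = N and y = "pi / l * (pi / 2) - pi / l * x"] by linarith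

section \<open>The Euler product\<close>

lemma norm_Ln_one_minus_le:
  fixes w :: complex
  assumes "norm w \<le> 1 / 2"
  shows "norm (Ln (1 - w)) \<le> 2 * norm w"
proof -
  have "norm (Ln (1 + - w) - - w) \<le> norm (- w) ^ 2 / (1 - norm (- w))"
    by (rule Ln_approx_linear) (use assms in auto)
  also have "\<dots> \<le> norm w ^ 2 / (1 / 2)"
    using assms by (intro frac_le) auto
  also have "\<dots> \<le> norm w"
    using assms mult_left_mono[of "norm w" "1 / 2" "norm w"] by (simp add: power2_eq_square)
  finally have "norm (Ln (1 - w) + w) \<le> norm w" by simp
  then show ?thesis
    using norm_triangle_ineq4[of "Ln (1 - w) + w" w] by simp
qed

text \<open>Sieving out one more prime multiplies the sum by \<open>1 - u p\<close>.\<close>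
lemma euler_product_tendsto:
  fixes u :: "nat \<Rightarrow> complex"
  assumes summ: "summable (\<lambda>n. norm (u n))"
    and u1: "u 1 = 1" and u_mult: "\<And>m n. u (m * n) = u m * u n"
  shows "(\<lambda>N. \<Prod>p<N. if prime p then 1 - u p else 1) \<longlonglongrightarrow> 1 / (\<Sum>n. u (Suc n))"
    and "(\<Sum>n. u (Suc n)) \<noteq> 0"
proof -
  define A where "A N = {n. n > 0 \<and> (\<forall>p. prime p \<longrightarrow> p < N \<longrightarrow> \<not> p dvd n)}" for N :: nat
  define P where "P N = (\<Prod>p<N. if prime p then 1 - u p else 1)" for N
  define Z where "Z = (\<Sum>n. u (Suc n))"
  have abs: "(\<lambda>n. norm (u n)) summable_on B" for B
    by (rule summable_on_subset_banach[OF norm_summable_imp_summable_on]) (use summ in auto)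
  have so: "u summable_on B" for B
    by (rule abs_summable_summable) (rule abs)
  have A0: "infsum u (A 0) = Z"
  proof -
    have "A 0 = range Suc" by (auto simp: A_def image_iff gr0_conv_Suc)
    then have "infsum u (A 0) = infsum (u \<circ> Suc) UNIV" by (simp add: infsum_reindex)
    also have "\<dots> = Z"
    proof -
      have "summable (\<lambda>n. norm (u (Suc n)))" using summ by (subst summable_Suc_iff)
      then show ?thesis unfolding Z_def o_def
        by (intro infsumI norm_summable_imp_has_sum summable_sums) (auto intro: summable_norm_cancel)
    qed
    finally show ?thesis .
  qed
  have step: "infsum u (A (Suc N)) = (if prime N then 1 - u N else 1) * infsum u (A N)" for N
  proof (cases "prime N")
    case False
    then have "A (Suc N) = A N" by (auto simp: A_def less_Suc_eq)
    with False show ?thesis by simp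
  next
    case True
    then have N0: "N > 0" by (simp add: prime_gt_0_nat)
    \<comment> \<open>\<open>A N\<close> is closed under multiplication by the prime
      \<open>N\<close> and under division of its multiples of \<open>N\<close>. The multiples are
      therefore a scaled copy of all of \<open>A N\<close>, and powers of \<open>N\<close> need not
      be tracked.\<close>
    have un: "A N = A (Suc N) \<union> (\<lambda>k. N * k) ` A N"
    proof (intro equalityI subsetI)
      fix n assume n: "n \<in> A N"
      show "n \<in> A (Suc N) \<union> (\<lambda>k. N * k) ` A N"
      proof (cases "N dvd n")
        case False
        then show ?thesis using n by (auto simp: A_def less_Suc_eq)
      next
        case True
        then obtain k where "n = N * k" by blast
        then show ?thesis using n by (intro UnI2 image_eqI[of _ _ k]) (auto simp: A_def)
      qed
    next
      fix n assume "n \<in> A (Suc N) \<union> (\<lambda>k. N * k) ` A N"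
      then show "n \<in> A N"
      proof
        assume "n \<in> A (Suc N)"
        then show ?thesis by (auto simp: A_def)
      next
        assume "n \<in> (\<lambda>k. N * k) ` A N"
        then obtain k where k: "n = N * k" "k \<in> A N" by blast
        have "\<not> p dvd n" if p: "prime p" "p < N" for p
        proof
          assume "p dvd n"
          then have "p dvd N \<or> p dvd k" using k p prime_dvd_mult_iff by blast
          then show False using k p True primes_dvd_imp_eq[of p N] by (auto simp: A_def)
        qed
        then show ?thesis
          using k N0 by (auto simp: A_def)
      qed
    qed
    have "infsum u (A N) = infsum u (A (Suc N)) + infsum u ((\<lambda>k. N * k) ` A N)"
      by (subst un, rule infsum_Un_disjoint[OF so so]) (use True in \<open>auto simp: A_def\<close>)
    also have "infsum u ((\<lambda>k. N * k) ` A N) = (\<Sum>\<^sub>\<infinity>n\<in>A N. u N * u n)"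
      using N0 by (subst infsum_reindex) (auto simp: inj_on_def o_def u_mult)
    also have "\<dots> = u N * infsum u (A N)"
      by (rule infsum_cmult_right) (use so in auto)
    finally have "infsum u (A (Suc N)) = infsum u (A N) - u N * infsum u (A N)"
      by (metis add_diff_cancel_right')
    then show ?thesis using True by (simp add: left_diff_distrib)
  qed
  have P: "P N * Z = infsum u (A N)" for N
  proof (induction N)
    case (Suc N)
    have "P (Suc N) * Z = (if prime N then 1 - u N else 1) * (P N * Z)" by (simp add: P_def)
    then show ?case by (simp only: Suc.IH step)
  qed (simp add: P_def A0)
  have tail0: "(\<lambda>N. \<Sum>n. norm (u (n + N))) \<longlonglongrightarrow> 0"
  proof -
    have "(\<lambda>N. (\<Sum>n. norm (u n)) - (\<Sum>n<N. norm (u n))) \<longlonglongrightarrow> (\<Sum>n. norm (u n)) - (\<Sum>n. norm (u n))"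
      by (intro tendsto_diff tendsto_const summable_LIMSEQ summ)
    then show ?thesis
      by (simp add: suminf_minus_initial_segment[OF summ])
  qed
  have "(\<lambda>N. P N * Z - 1) \<longlonglongrightarrow> 0"
  proof (rule Lim_null_comparison[OF _ tail0], rule eventually_sequentiallyI[of 2])
    fix N :: nat assume N: "2 \<le> N"
    \<comment> \<open>A survivor other than 1 has a prime factor, which is at least
      \<open>N\<close>. So only the term at 1 and a tail of the absolutely convergent series
      remain.\<close>
    have sub: "A N - {1} \<subseteq> {N..}"
    proof
      fix n assume n: "n \<in> A N - {1}"
      then obtain p where "prime p" "p dvd n" using prime_factor_nat[of n] by auto
      then have "\<not> p < N" "p \<le> n" using n by (auto simp: A_def dest: dvd_imp_le)
      then show "n \<in> {N..}" by simp
    qed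
    have "1 \<in> A N" by (auto simp: A_def)
    then have "infsum u (A N) = infsum u {1} + infsum u (A N - {1})"
      by (subst infsum_Un_disjoint[OF so so, symmetric]) (auto intro: arg_cong[where f = "infsum u"])
    then have "P N * Z - 1 = infsum u (A N - {1})" using P u1 by simp
    also have "norm \<dots> \<le> infsum (\<lambda>n. norm (u n)) (A N - {1})"
      by (rule norm_infsum_bound[OF abs])
    also have "\<dots> \<le> infsum (\<lambda>n. norm (u n)) {N..}"
      by (rule infsum_mono_neutral) (use abs sub in auto)
    also have "{N..} = range (\<lambda>n. n + N)" by (auto simp: image_iff le_iff_add add.commute)
    also have "infsum (\<lambda>n. norm (u n)) (range (\<lambda>n. n + N)) = infsum (\<lambda>n. norm (u (n + N))) UNIV"
      by (subst infsum_reindex) (auto simp: o_def)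
    also have "\<dots> = (\<Sum>n. norm (u (n + N)))"
    proof -
      have "summable (\<lambda>n. norm (u (n + N)))" using summ by (subst summable_iff_shift)
      then show ?thesis
        by (intro infsumI norm_summable_imp_has_sum summable_sums) auto
    qed
    finally show "norm (P N * Z - 1) \<le> (\<Sum>n. norm (u (n + N)))" .
  qed
  then have lim: "(\<lambda>N. P N * Z) \<longlonglongrightarrow> 1" by (simp add: LIM_zero_iff)
  \<comment> \<open>\<open>P N * Z\<close> tends to 1, which is impossible for \<open>Z = 0\<close>;
    non-vanishing thus falls out of the sieve itself.\<close>
  show Z: "(\<Sum>n. u (Suc n)) \<noteq> 0" unfolding Z_def [symmetric]
  proof
    assume "Z = 0"
    with lim have "(\<lambda>N::nat. 0 :: complex) \<longlonglongrightarrow> 1" by simp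
    then show False using LIMSEQ_unique tendsto_const zero_neq_one by blast
  qed
  then have "(\<lambda>N. P N * Z / Z) \<longlonglongrightarrow> 1 / Z"
    unfolding Z_def [symmetric] by (intro tendsto_divide lim tendsto_const)
  then show "(\<lambda>N. \<Prod>p<N. if prime p then 1 - u p else 1) \<longlonglongrightarrow> 1 / (\<Sum>n. u (Suc n))"
    using Z by (simp add: P_def Z_def)
qed

text \<open>This is \<open>p^(-it)\<close>. It has the type of \<open>z\<close> with the time
  \<open>t\<close> in the place of the sample point, so \<open>random_log_euler\<close> applies
  verbatim to both.\<close>

definition prime_flow :: "nat \<Rightarrow> real \<Rightarrow> complex" where
  "prime_flow p t = cis (- (t * ln (real p)))"

lemma norm_prime_flow [simp]: "norm (prime_flow p t) = 1"
  by (simp add: prime_flow_def)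

lemma prime_powr_minus_le:
  assumes "\<sigma> > 1" "prime p"
  shows "real p powr - \<sigma> \<le> 1 / 2"
proof -
  have p: "real p \<ge> 2" using assms(2) prime_ge_2_nat by fastforce
  have "real p powr - \<sigma> \<le> real p powr - 1" using p assms by (intro powr_mono) auto
  also have "\<dots> \<le> 1 / 2" using p by (simp add: powr_minus_divide field_simps)
  finally show ?thesis .
qed

lemma summable_nat_powr_minus:
  assumes "\<sigma> > 1"
  shows "summable (\<lambda>n. real n powr - \<sigma>)"
  using assms by (simp add: summable_real_powr_iff)

text \<open>A function of the point \<open>w\<close> of the circle alone, so that one norm bound and
  one power series serve both the random variables and the flow. The value 0 off the primes lets
  sums run over all natural numbers.\<close>

definition euler_summand :: "real \<Rightarrow> nat \<Rightarrow> complex \<Rightarrow> complex" where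
  "euler_summand \<sigma> p w = (if prime p then - Ln (1 - of_real (real p powr - \<sigma>) * w) else 0)"

lemma norm_euler_summand_le:
  assumes "\<sigma> > 1" "prime p \<Longrightarrow> norm w = 1"
  shows "norm (euler_summand \<sigma> p w) \<le> 2 * real p powr - \<sigma>"
proof (cases "prime p")
  case True
  have "norm (Ln (1 - of_real (real p powr - \<sigma>) * w)) \<le> 2 * norm (of_real (real p powr - \<sigma>) * w)"
    using prime_powr_minus_le[OF assms(1) True] assms(2) True
    by (intro norm_Ln_one_minus_le) (simp add: norm_mult)
  then show ?thesis using True assms by (simp add: euler_summand_def norm_mult)
qed (auto simp: euler_summand_def)

lemma euler_summand_sums:
  assumes "\<sigma> > 1" "\<And>p. prime p \<Longrightarrow> norm (z p \<omega>) = 1"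
  shows "summable (\<lambda>p. norm (euler_summand \<sigma> p (z p \<omega>)))"
    and "(\<lambda>p. euler_summand \<sigma> p (z p \<omega>)) sums random_log_euler z \<sigma> \<omega>"
proof -
  show s: "summable (\<lambda>p. norm (euler_summand \<sigma> p (z p \<omega>)))"
    by (rule summable_comparison_test'[OF summable_mult[OF summable_nat_powr_minus[OF assms(1)]], of 0 _ 2])
       (use norm_euler_summand_le assms in auto)
  have "(\<lambda>p. - euler_summand \<sigma> p (z p \<omega>)) sums - (\<Sum>p. euler_summand \<sigma> p (z p \<omega>))"
    by (intro sums_minus summable_sums summable_norm_cancel[OF s])
  moreover have "(\<lambda>p. - euler_summand \<sigma> p (z p \<omega>)) =
      (\<lambda>p. if prime p then Ln (1 - of_real (real p powr (- \<sigma>)) * z p \<omega>) else 0)"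
    by (auto simp: euler_summand_def)
  ultimately have "random_log_euler z \<sigma> \<omega> = (\<Sum>p. euler_summand \<sigma> p (z p \<omega>))"
    unfolding random_log_euler_def by (simp add: sums_iff)
  then show "(\<lambda>p. euler_summand \<sigma> p (z p \<omega>)) sums random_log_euler z \<sigma> \<omega>"
    using summable_norm_cancel[OF s] by (simp add: summable_sums)
qed

text \<open>The exponential of a negated partial sum over the primes is a partial product of the
  factors \<open>1 - u p\<close>. Continuity of \<open>exp\<close> then identifies the limit with
  the reciprocal of zeta that the sieve delivers.\<close>

lemma zeta_eq_exp_random_log_euler:
  assumes "\<sigma> > 1"
  shows "zeta (Complex \<sigma> t) = exp (random_log_euler prime_flow \<sigma> t)"
proof -
  define u :: "nat \<Rightarrow> complex"
    where "u n = (if n = 0 then 0 else of_real (real n powr - \<sigma>) * prime_flow n t)" for n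
  have nu: "norm (u n) = real n powr - \<sigma>" for n
    by (simp add: u_def norm_mult)
  have summ: "summable (\<lambda>n. norm (u n))"
    unfolding nu by (rule summable_nat_powr_minus[OF assms])
  have u1: "u 1 = 1" by (simp add: u_def prime_flow_def)
  have um: "u (m * n) = u m * u n" for m n
    by (simp add: u_def prime_flow_def powr_mult ln_mult cis_mult algebra_simps)
  have zu: "zeta (Complex \<sigma> t) = (\<Sum>n. u (Suc n))"
  proof -
    have "1 / of_nat (Suc n) powr Complex \<sigma> t = u (Suc n)" for n
    proof -
      have "1 / of_nat (Suc n) powr Complex \<sigma> t = exp (- (Complex \<sigma> t * of_real (ln (real (Suc n)))))"
        using Ln_of_real[of "real (Suc n)"]
        by (simp add: powr_def exp_minus inverse_eq_divide del: of_nat_Suc)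
      also have "- (Complex \<sigma> t * of_real (ln (real (Suc n)))) =
          of_real (- \<sigma> * ln (real (Suc n))) + \<i> * of_real (- (t * ln (real (Suc n))))"
        by (simp add: complex_eq_iff)
      also have "exp \<dots> = u (Suc n)"
        unfolding exp_add u_def prime_flow_def cis_conv_exp exp_of_real
        by (simp add: powr_def)
      finally show ?thesis .
    qed
    then show ?thesis using assms by (simp add: zeta_def)
  qed
  note ep = euler_product_tendsto[OF summ u1 um]
  have lt: "norm (u p) < 1" if "prime p" for p
    using prime_powr_minus_le[OF assms that] by (simp add: nu)
  have S: "(\<lambda>p. euler_summand \<sigma> p (prime_flow p t)) sums random_log_euler prime_flow \<sigma> t"
    by (rule euler_summand_sums) (use assms in auto)
  have "(\<lambda>N. exp (- (\<Sum>p<N. euler_summand \<sigma> p (prime_flow p t)))) \<longlonglongrightarrow> exp (- random_log_euler prime_flow \<sigma> t)"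
    using S unfolding sums_def by (intro tendsto_intros)
  moreover have "exp (- (\<Sum>p<N. euler_summand \<sigma> p (prime_flow p t))) = (\<Prod>p<N. if prime p then 1 - u p else 1)" for N
  proof -
    have "exp (- euler_summand \<sigma> p (prime_flow p t)) = (if prime p then 1 - u p else 1)" for p
    proof (cases "prime p")
      case True
      then have "u p = of_real (real p powr - \<sigma>) * prime_flow p t" by (simp add: u_def prime_gt_0_nat)
      moreover have "1 - u p \<noteq> 0" using lt[OF True] by auto
      ultimately show ?thesis using True by (simp add: euler_summand_def)
    qed (simp add: euler_summand_def)
    then show ?thesis by (simp add: sum_negf [symmetric] exp_sum)
  qed
  ultimately have "exp (- random_log_euler prime_flow \<sigma> t) = 1 / zeta (Complex \<sigma> t)"
    using ep(1) zu by (simp add: LIMSEQ_unique)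
  then show ?thesis using ep(2) zu by (simp add: exp_minus field_simps)
qed

lemma continuous_on_random_log_euler_prime_flow:
  assumes "\<sigma> > 1"
  shows "continuous_on UNIV (random_log_euler prime_flow \<sigma>)"
proof (rule uniform_limit_theorem)
  have "uniform_limit UNIV (\<lambda>N t. \<Sum>p<N. euler_summand \<sigma> p (prime_flow p t))
      (\<lambda>t. \<Sum>p. euler_summand \<sigma> p (prime_flow p t)) sequentially"
    by (rule Weierstrass_m_test[OF _ summable_mult[OF summable_nat_powr_minus[OF assms], of 2]])
       (use norm_euler_summand_le assms in auto)
  also have "(\<lambda>t. \<Sum>p. euler_summand \<sigma> p (prime_flow p t)) = random_log_euler prime_flow \<sigma>"
    using euler_summand_sums(2)[OF assms, of prime_flow] by (auto simp: sums_iff)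
  finally show "uniform_limit UNIV (\<lambda>N t. \<Sum>p<N. euler_summand \<sigma> p (prime_flow p t))
      (random_log_euler prime_flow \<sigma>) sequentially" .
  have "continuous_on UNIV (\<lambda>t. euler_summand \<sigma> p (prime_flow p t))" for p
  proof (cases "prime p")
    case True
    have "1 - of_real (real p powr - \<sigma>) * prime_flow p t \<notin> \<real>\<^sub>\<le>\<^sub>0" for t
    proof -
      have "Re (of_real (real p powr - \<sigma>) * prime_flow p t) \<le> 1 / 2"
        using prime_powr_minus_le[OF assms True]
        by (intro order_trans[OF complex_Re_le_cmod]) (simp add: norm_mult)
      then show ?thesis by (simp add: complex_nonpos_Reals_iff)
    qed
    moreover have "continuous_on UNIV (prime_flow p)"
      unfolding prime_flow_def cis_conv_exp by (intro continuous_intros)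
    ultimately show ?thesis
      using True by (simp add: euler_summand_def) (intro continuous_intros, auto)
  qed (simp add: euler_summand_def)
  then show "\<forall>\<^sub>F N in sequentially. continuous_on UNIV (\<lambda>t. \<Sum>p<N. euler_summand \<sigma> p (prime_flow p t))"
    by (intro always_eventually allI continuous_on_sum) auto
qed simp

section \<open>The branch of log zeta to the right of 1\<close>

lemma zeta_no_pole:
  assumes "Re s > 1"
  shows "\<not> is_pole zeta s"
proof
  assume pole: "is_pole zeta s"
  \<comment> \<open>Halfway between 1 and \<open>Re s\<close>: near \<open>s\<close> the Dirichlet
    series is bounded by its value at \<open>x\<close>, whereas a pole would make
    \<open>zeta\<close> unbounded there.\<close>
  define x where "x = (1 + Re s) / 2"
  have x: "1 < x" "x < Re s" using assms by (auto simp: x_def)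
  define C where "C = (\<Sum>n. real (Suc n) powr - x)"
  have summ: "summable (\<lambda>n. real (Suc n) powr - x)"
    using summable_nat_powr_minus[OF x(1)] by (subst summable_Suc_iff)
  have bd: "norm (zeta w) \<le> C" if "Re w > x" for w
  proof -
    have "norm (\<Sum>n. 1 / of_nat (Suc n) powr w :: complex) \<le> C"
      unfolding C_def
    proof (rule norm_suminf_le[OF _ summ])
      fix n
      have "norm (1 / of_nat (Suc n) powr w) = 1 / real (Suc n) powr Re w"
        using norm_powr_real_powr[of "of_nat (Suc n)" w] by (simp add: norm_divide)
      also have "\<dots> = real (Suc n) powr - Re w" by (simp add: powr_minus_divide)
      also have "\<dots> \<le> real (Suc n) powr - x" using that by (intro powr_mono) auto
      finally show "norm (1 / of_nat (Suc n) powr w) \<le> real (Suc n) powr - x" .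
    qed
    then show ?thesis using that x by (simp add: zeta_def)
  qed
  have "\<forall>\<^sub>F w in at s. norm (zeta w) > C"
    using pole unfolding is_pole_def filterlim_at_infinity_conv_norm_at_top filterlim_at_top_dense by blast
  moreover have "\<forall>\<^sub>F w in at s. Re w > x"
    by (rule order_tendstoD) (use x in \<open>auto intro!: tendsto_intros\<close>)
  ultimately have "\<forall>\<^sub>F w in at s. False"
    by eventually_elim (use bd in force)
  then show False by (simp add: eventually_False)
qed

lemma halfplane_in_cut_plane:
  assumes "\<sigma> > 1"
  shows "Complex \<sigma> t \<in> cut_plane"
proof -
  have "zeta \<rho> \<noteq> 0" "\<not> is_pole zeta \<rho>" if "Re \<rho> \<ge> \<sigma>" for \<rho>
    using that assms zeta_eq_exp_random_log_euler[of "Re \<rho>" "Im \<rho>"] zeta_no_pole[of \<rho>] by auto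
  then show ?thesis unfolding cut_plane_def by auto
qed

text \<open>Conjugation turns \<open>p^(-it)\<close> into \<open>p^(it)\<close> and commutes with
  \<open>Ln\<close> off its cut. At \<open>t = 0\<close> this fixes the branch of the logarithm; for
  general \<open>t\<close> it makes \<open>psi\<close> real.\<close>

lemma Im_random_log_euler_minus:
  assumes "\<sigma> > 1"
  shows "Im (random_log_euler prime_flow \<sigma> (- t)) = - Im (random_log_euler prime_flow \<sigma> t)"
proof -
  have "random_log_euler prime_flow \<sigma> (- t) = cnj (random_log_euler prime_flow \<sigma> t)"
  proof (rule sums_unique2)
    show "(\<lambda>p. euler_summand \<sigma> p (prime_flow p (- t))) sums random_log_euler prime_flow \<sigma> (- t)"
      by (rule euler_summand_sums) (use assms in auto)
    have "cnj (euler_summand \<sigma> p (prime_flow p t)) = euler_summand \<sigma> p (prime_flow p (- t))" for p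
    proof (cases "prime p")
      case True
      have "Re (of_real (real p powr - \<sigma>) * prime_flow p t) \<le> 1 / 2"
        using prime_powr_minus_le[OF assms True]
        by (intro order_trans[OF complex_Re_le_cmod]) (simp add: norm_mult)
      then have "1 - of_real (real p powr - \<sigma>) * prime_flow p t \<notin> \<real>\<^sub>\<le>\<^sub>0"
        by (simp add: complex_nonpos_Reals_iff)
      then show ?thesis
        using True by (simp add: euler_summand_def cnj_Ln prime_flow_def cis_cnj)
    qed (simp add: euler_summand_def)
    moreover have "(\<lambda>p. cnj (euler_summand \<sigma> p (prime_flow p t))) sums cnj (random_log_euler prime_flow \<sigma> t)"
      unfolding sums_cnj by (rule euler_summand_sums(2)) (use assms in auto)
    ultimately show "(\<lambda>p. euler_summand \<sigma> p (prime_flow p (- t))) sums cnj (random_log_euler prime_flow \<sigma> t)"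
      by simp
  qed
  then show ?thesis by simp
qed

text \<open>Both sides are continuous logarithms of the same function on a line. Their difference
  takes values in the integer multiples of \<open>2 * pi * \<i>\<close>, which are at least
  \<open>2 * pi\<close> apart, so it is constant; at \<open>t = 0\<close> both logarithms are
  real.\<close>

lemma log_zeta_eq_random_log_euler:
  assumes lz: "is_log_zeta log_zeta" and \<sigma>: "\<sigma> > 1"
  shows "log_zeta (Complex \<sigma> t) = random_log_euler prime_flow \<sigma> t"
proof -
  define D where "D t = log_zeta (Complex \<sigma> t) - random_log_euler prime_flow \<sigma> t" for t
  have "continuous_on UNIV (\<lambda>t. log_zeta (Complex \<sigma> t))"
  proof (rule continuous_on_compose2[of cut_plane log_zeta UNIV "Complex \<sigma>"])
    show "continuous_on cut_plane log_zeta"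
      using lz by (simp add: is_log_zeta_def holomorphic_on_imp_continuous_on)
    show "continuous_on UNIV (Complex \<sigma>)"
      unfolding Complex_eq by (intro continuous_intros)
  qed (use \<sigma> halfplane_in_cut_plane in auto)
  then have contD: "continuous_on UNIV D"
    unfolding D_def by (intro continuous_intros continuous_on_random_log_euler_prime_flow \<sigma>)
  have "exp (D t) = 1" for t
    using lz halfplane_in_cut_plane[OF \<sigma>] zeta_eq_exp_random_log_euler[OF \<sigma>]
    by (simp add: D_def exp_diff is_log_zeta_def)
  then have D: "Re (D t) = 0" "\<exists>n. Im (D t) = of_int (2 * n) * pi" for t
    by (simp_all add: exp_eq_1)
  have "D constant_on UNIV"
  proof (rule continuous_discrete_range_constant[OF _ contD])
    fix t
    show "\<exists>e>0. \<forall>s. s \<in> UNIV \<and> D s \<noteq> D t \<longrightarrow> e \<le> norm (D s - D t)"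
    proof (intro exI[of _ "2 * pi"] conjI allI impI)
      fix s assume ne: "s \<in> UNIV \<and> D s \<noteq> D t"
      obtain m n where mn: "Im (D s) = of_int (2 * m) * pi" "Im (D t) = of_int (2 * n) * pi"
        using D(2) by metis
      then have "m \<noteq> n" using ne D(1) by (auto simp: complex_eq_iff)
      then have "1 \<le> \<bar>real_of_int (m - n)\<bar>" by linarith
      then have "2 * pi * 1 \<le> 2 * pi * \<bar>real_of_int (m - n)\<bar>" by (intro mult_left_mono) auto
      also have "\<dots> = \<bar>Im (D s - D t)\<bar>"
      proof -
        have "Im (D s - D t) = 2 * pi * real_of_int (m - n)"
          using mn by (simp add: algebra_simps)
        then show ?thesis by (simp only: abs_mult) simp
      qed
      also have "\<dots> \<le> norm (D s - D t)" by (rule abs_Im_le_cmod)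
      finally show "2 * pi \<le> norm (D s - D t)" by simp
    qed simp
  qed simp
  then have "D t = D 0" by (auto simp: constant_on_def)
  moreover have "D 0 = 0"
  proof -
    have "log_zeta (of_real \<sigma>) \<in> \<real>" using lz \<sigma> by (simp add: is_log_zeta_def)
    then have "Im (D 0) = 0"
      using Im_random_log_euler_minus[OF \<sigma>, of 0]
      by (simp add: D_def complex_of_real_def complex_is_Real_iff)
    then show ?thesis using D(1) by (simp add: complex_eq_iff)
  qed
  ultimately show ?thesis by (simp add: D_def)
qed

section \<open>Mean values of almost periodic functions\<close>

lemma integral_uniform_measure_lborel:
  fixes f :: "real \<Rightarrow> 'b::{banach, second_countable_topology}"
  assumes [measurable]: "A \<in> sets borel" "f \<in> borel_measurable borel"
    and A: "0 < measure lborel A"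
  shows "(\<integral>t. f t \<partial>uniform_measure lborel A) =
    (1 / measure lborel A) *\<^sub>R (\<integral>t. indicator A t *\<^sub>R f t \<partial>lborel)"
proof -
  have fin: "emeasure lborel A = ennreal (measure lborel A)"
    by (rule emeasure_eq_ennreal_measure) (use A in \<open>auto simp: measure_def\<close>)
  have "uniform_measure lborel A = density lborel (\<lambda>t. ennreal (indicator A t / measure lborel A))"
    unfolding uniform_measure_def
    by (intro density_cong) (use A in \<open>auto simp: fin divide_ennreal split: split_indicator simp flip: ennreal_1\<close>)
  then have "(\<integral>t. f t \<partial>uniform_measure lborel A) =
      (\<integral>t. (indicator A t / measure lborel A) *\<^sub>R f t \<partial>lborel)"
    using A by (simp add: integral_density)
  also have "\<dots> = (\<integral>t. (1 / measure lborel A) *\<^sub>R (indicator A t *\<^sub>R f t) \<partial>lborel)"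
    by (intro Bochner_Integration.integral_cong) auto
  also have "\<dots> = (1 / measure lborel A) *\<^sub>R (\<integral>t. indicator A t *\<^sub>R f t \<partial>lborel)"
    by (rule integral_scaleR_right)
  finally show ?thesis .
qed

lemma integral_cis:
  assumes "a \<le> b" "c \<noteq> 0"
  shows "(\<integral>t. indicator {a..b} t *\<^sub>R cis (c * t) \<partial>lborel) = (cis (c * b) - cis (c * a)) / (\<i> * of_real c)"
proof -
  have "(\<integral>t. indicator {a..b} t *\<^sub>R cis (c * t) \<partial>lborel)
     = cis (c * b) / (\<i> * of_real c) - cis (c * a) / (\<i> * of_real c)"
  proof (rule integral_FTC_Icc[OF assms(1)])
    fix x
    have "((\<lambda>t. exp (\<i> * of_real c * t) / (\<i> * of_real c)) has_field_derivative exp (\<i> * of_real c * of_real x)) (at (of_real x))"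
      using assms by (auto intro!: derivative_eq_intros)
    from has_complex_derivative_imp_has_vector_derivative[OF has_field_derivative_at_within[OF this]]
    have "((\<lambda>t. exp (\<i> * of_real c * of_real t) / (\<i> * of_real c)) has_vector_derivative exp (\<i> * of_real c * of_real x)) (at x within {a..b})"
      by (simp add: o_def)
    then show "((\<lambda>t. cis (c * t) / (\<i> * of_real c)) has_vector_derivative cis (c * x)) (at x within {a..b})"
      by (simp add: cis_conv_exp mult.assoc)
  next
    show "continuous_on {a..b} (\<lambda>t. cis (c * t))"
      unfolding cis_conv_exp by (intro continuous_intros)
  qed
  then show ?thesis by (simp add: diff_divide_distrib)
qed

lemma cis_measurable [measurable]: "cis \<in> borel_measurable borel"
  by (intro borel_measurable_continuous_onI) (auto simp: cis_conv_exp intro!: continuous_intros)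

lemma sets_uniform_circle [measurable_cong, simp]: "sets uniform_circle = sets borel"
  by (simp add: uniform_circle_def)

lemma AE_uniform_circle: "AE w in uniform_circle. norm w = 1"
  unfolding uniform_circle_def by (subst AE_distr_iff) auto

text \<open>Orthogonality of the characters of the circle. Powers of \<open>w\<close> and of
  \<open>cnj w\<close> are kept apart because the exponent \<open>m - n\<close> of the character may
  be negative.\<close>

lemma integral_uniform_circle_powers:
  assumes "m \<noteq> n"
  shows "(\<integral>w. w ^ m * cnj w ^ n \<partial>uniform_circle) = 0"
proof -
  have [measurable]: "cnj \<in> borel_measurable borel"
    by (intro borel_measurable_continuous_onI continuous_intros)
  define c where "c = real m - real n"
  have c: "c \<noteq> 0" using assms by (simp add: c_def)
  have [simp]: "cis (2 * pi * c) = 1" "cis (c * (2 * pi)) = 1"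
    using cis_multiple_2pi[of c] by (simp_all add: c_def mult.commute)
  have "(\<integral>w. w ^ m * cnj w ^ n \<partial>uniform_circle) =
      (\<integral>t. cis t ^ m * cnj (cis t) ^ n \<partial>uniform_measure lborel {0..<2 * pi})"
    unfolding uniform_circle_def by (rule integral_distr) auto
  also have "\<dots> = (\<integral>t. cis (c * t) \<partial>uniform_measure lborel {0..<2 * pi})"
    by (intro Bochner_Integration.integral_cong)
       (auto simp: cis_cnj Complex.DeMoivre cis_mult c_def algebra_simps)
  also have "\<dots> = (1 / (2 * pi)) *\<^sub>R (\<integral>t. indicator {0..<2 * pi} t *\<^sub>R cis (c * t) \<partial>lborel)"
    by (subst integral_uniform_measure_lborel) auto
  also have "(\<integral>t. indicator {0..<2 * pi} t *\<^sub>R cis (c * t) \<partial>lborel) =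
      (\<integral>t. indicator {0..2 * pi} t *\<^sub>R cis (c * t) \<partial>lborel)"
  proof (rule integral_cong_AE)
    show "AE t in lborel. indicator {0..<2 * pi} t *\<^sub>R cis (c * t) = indicator {0..2 * pi} t *\<^sub>R cis (c * t)"
      using AE_lborel_singleton[of "2 * pi"] by eventually_elim (auto split: split_indicator)
  qed auto
  also have "\<dots> = 0"
    using c by (subst integral_cis) auto
  finally show ?thesis by simp
qed

text \<open>\<open>P\<close> may exceed the support of \<open>A\<close>, so that the factorizations
  of two numbers can be written over one common set of primes.\<close>

lemma prod_mset_image_mset_eq_prod:
  fixes f :: "'b \<Rightarrow> 'c::comm_monoid_mult"
  assumes "finite P" "set_mset A \<subseteq> P"
  shows "(\<Prod>p\<in>#A. f p) = (\<Prod>p\<in>P. f p ^ count A p)"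
  using assms(2)
proof (induction A)
  case (add x A)
  have "(\<Prod>p\<in>P. f p ^ count (add_mset x A) p) = (\<Prod>p\<in>P. (if p = x then f p else 1) * f p ^ count A p)"
    by (intro prod.cong) auto
  also have "\<dots> = (\<Prod>p\<in>P. if p = x then f p else 1) * (\<Prod>p\<in>P. f p ^ count A p)"
    by (rule prod.distrib)
  also have "(\<Prod>p\<in>P. if p = x then f p else 1) = f x"
    using add.prems assms(1) by (simp add: prod.delta')
  finally show ?case using add by simp
qed simp

abbreviation unif_interval :: "real \<Rightarrow> real measure" where
  "unif_interval T \<equiv> uniform_measure lborel {-T..T}"

lemma prob_space_unif_interval: "T > 0 \<Longrightarrow> prob_space (unif_interval T)"
  by (intro prob_space_uniform_measure) auto

text \<open>For \<open>c \<noteq> 0\<close> the oscillating integral is at most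
  \<open>2 / \<bar>c\<bar>\<close> however long the interval, while the normalizing length
  \<open>2 * T\<close> grows.\<close>

lemma mean_cis_tendsto:
  "((\<lambda>T. \<integral>t. cis (c * t) \<partial>unif_interval T) \<longlongrightarrow> of_bool (c = 0)) at_top"
proof (cases "c = 0")
  case True
  have "\<forall>\<^sub>F T in at_top. (\<integral>t. cis (c * t) \<partial>unif_interval T) = of_bool (c = 0)"
    using eventually_gt_at_top[of 0]
  proof eventually_elim
    case (elim T)
    then interpret prob_space "unif_interval T" by (rule prob_space_unif_interval)
    show ?case using True prob_space by simp
  qed
  then show ?thesis by (rule tendsto_eventually)
next
  case False
  have "((\<lambda>T. \<integral>t. cis (c * t) \<partial>unif_interval T) \<longlongrightarrow> 0) at_top"
  proof (rule Lim_null_comparison)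
    show "\<forall>\<^sub>F T in at_top. norm (\<integral>t. cis (c * t) \<partial>unif_interval T) \<le> 1 / \<bar>c\<bar> * inverse T"
      using eventually_gt_at_top[of 0]
    proof eventually_elim
      case (elim T)
      have "norm (cis (c * T) - cis (c * - T)) \<le> 2"
        using norm_triangle_ineq4[of "cis (c * T)" "cis (c * - T)"] by simp
      moreover have "(\<integral>t. cis (c * t) \<partial>unif_interval T) =
          (1 / (2 * T)) *\<^sub>R ((cis (c * T) - cis (c * - T)) / (\<i> * of_real c))"
        using elim False by (subst integral_uniform_measure_lborel) (auto simp: integral_cis)
      ultimately show ?case
        using elim False by (simp add: norm_divide norm_mult divide_simps) 
    qed
    show "((\<lambda>T. 1 / \<bar>c\<bar> * inverse T) \<longlongrightarrow> 0) at_top"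
      using tendsto_mult_right_zero[OF tendsto_inverse_0_at_top[OF filterlim_ident]] by blast
  qed
  then show ?thesis using False by simp
qed

section \<open>The random model and its characters\<close>

locale random_euler = prob_space M for M :: "'a measure" +
  fixes z :: "nat \<Rightarrow> 'a \<Rightarrow> complex"
  assumes indep: "indep_vars (\<lambda>_. borel) z {p. prime p}"
    and distr_z: "\<And>p. prime p \<Longrightarrow> distr M borel (z p) = uniform_circle"
begin

lemma z_measurable [measurable (raw)]: "prime p \<Longrightarrow> z p \<in> borel_measurable M"
  using indep by (auto simp: indep_vars_def)

text \<open>One set of full measure, fixed once, allows bounds and approximations on the random side
  to be pointwise and uniform, with no null sets to collect at each operation.\<close>

definition good :: "'a set" where
  "good = {\<omega>\<in>space M. \<forall>p. prime p \<longrightarrow> norm (z p \<omega>) = 1}"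

lemma AE_good: "AE \<omega> in M. \<omega> \<in> good"
proof -
  have "AE \<omega> in M. norm (z p \<omega>) = 1" if "prime p" for p
    using AE_uniform_circle that by (subst (asm) distr_z [symmetric, OF that], subst (asm) AE_distr_iff) auto
  then have "AE \<omega> in M. \<forall>p. prime p \<longrightarrow> norm (z p \<omega>) = 1"
    by (subst AE_all_countable) auto
  then show ?thesis by (auto simp: good_def)
qed

text \<open>
  \<open>char_flow m n t\<close> is \<open>(m/n)^(-it)\<close>; its random model replaces \<open>p^(-it)\<close> by \<open>z p\<close>. Both have mean
  1 if \<open>m = n\<close> and 0 otherwise, the latter by unique factorization.
\<close>
definition char_flow :: "nat \<Rightarrow> nat \<Rightarrow> real \<Rightarrow> complex" where
  "char_flow m n t = cis ((ln (real n) - ln (real m)) * t)"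

definition steinhaus :: "nat \<Rightarrow> 'a \<Rightarrow> complex" where
  "steinhaus n \<omega> = (\<Prod>p\<in>#prime_factorization n. z p \<omega>)"

definition char_rand :: "nat \<Rightarrow> nat \<Rightarrow> 'a \<Rightarrow> complex" where
  "char_rand m n \<omega> = steinhaus m \<omega> * cnj (steinhaus n \<omega>)"

lemma char_rand_eq_prod:
  fixes m n :: nat
  defines "P \<equiv> prime_factors m \<union> prime_factors n"
  shows "char_rand m n \<omega> = (\<Prod>p\<in>P. z p \<omega> ^ multiplicity p m * cnj (z p \<omega>) ^ multiplicity p n)"
proof -
  have "steinhaus k \<omega> = (\<Prod>p\<in>P. z p \<omega> ^ multiplicity p k)" if "k \<in> {m, n}" for k
  proof -
    have "steinhaus k \<omega> = (\<Prod>p\<in>P. z p \<omega> ^ count (prime_factorization k) p)"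
      unfolding steinhaus_def by (rule prod_mset_image_mset_eq_prod) (use that in \<open>auto simp: P_def\<close>)
    also have "\<dots> = (\<Prod>p\<in>P. z p \<omega> ^ multiplicity p k)"
      by (intro prod.cong) (auto simp: P_def count_prime_factorization)
    finally show ?thesis .
  qed
  then show ?thesis by (simp add: char_rand_def prod.distrib)
qed

lemma char_rand_measurable [measurable]: "char_rand m n \<in> borel_measurable M"
proof -
  have [measurable]: "cnj \<in> borel_measurable borel"
    by (intro borel_measurable_continuous_onI continuous_intros)
  have "(\<lambda>\<omega>. z p \<omega> ^ multiplicity p m * cnj (z p \<omega>) ^ multiplicity p n) \<in> borel_measurable M"
    if "prime p" for p
    using z_measurable[OF that] by measurable
  then show ?thesis unfolding char_rand_eq_prod[abs_def]
    by (intro borel_measurable_prod) (auto simp: in_prime_factors_iff)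
qed

lemma norm_char_rand: "\<omega> \<in> good \<Longrightarrow> norm (char_rand m n \<omega>) = 1"
  unfolding char_rand_eq_prod
  by (auto simp: prod_norm [symmetric] norm_mult norm_power good_def intro!: prod.neutral)

lemma expectation_char_rand:
  assumes "m > 0" "n > 0"
  shows "expectation (char_rand m n) = of_bool (m = n)"
proof (cases "m = n")
  case True
  \<comment> \<open>\<open>steinhaus 1\<close> is an empty product, so the case of \<open>n\<close>
    and 1 in \<open>norm_char_rand\<close> says that \<open>steinhaus n \<omega>\<close> has modulus
    1.\<close>
  have "char_rand n n \<omega> = 1" if "\<omega> \<in> good" for \<omega>
    using norm_char_rand[OF that, of n 1] complex_norm_square[of "steinhaus n \<omega>"]
    by (simp add: char_rand_def steinhaus_def)
  then have "AE \<omega> in M. char_rand m n \<omega> = 1"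
    using AE_good True by (auto elim: eventually_mono)
  then have "expectation (char_rand m n) = expectation (\<lambda>_. 1)"
    by (intro integral_cong_AE) auto
  then show ?thesis using True prob_space by simp
next
  case False
  have [measurable]: "cnj \<in> borel_measurable borel"
    by (intro borel_measurable_continuous_onI continuous_intros)
  define P where "P = prime_factors m \<union> prime_factors n"
  define X where "X p w = w ^ multiplicity p m * cnj w ^ multiplicity p n" for p and w :: complex
  have [measurable]: "X p \<in> borel_measurable borel" for p unfolding X_def by measurable
  have P: "finite P" "P \<subseteq> {p. prime p}" by (auto simp: P_def)
  \<comment> \<open>Independence turns the expectation into a product over \<open>P\<close>, so a
    single prime with different exponents suffices: its factor integrates to 0 over the
    circle.\<close>
  have "\<exists>q\<in>P. multiplicity q m \<noteq> multiplicity q n"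
  proof (rule ccontr)
    assume "\<not> ?thesis"
    then have eq: "multiplicity q m = multiplicity q n" if "q \<in> P" for q using that by blast
    have "m = n"
    proof (rule multiplicity_eq_nat)
      fix p :: nat assume p: "prime p"
      show "multiplicity p m = multiplicity p n"
      proof (cases "p \<in> P")
        case False
        then show ?thesis using p assms
          by (auto simp: P_def in_prime_factors_iff not_dvd_imp_multiplicity_0)
      qed (rule eq)
    qed (use assms in auto)
    with False show False by simp
  qed
  then obtain q where q: "q \<in> P" "multiplicity q m \<noteq> multiplicity q n" by blast
  have ind: "indep_vars (\<lambda>_. borel) (\<lambda>p \<omega>. X p (z p \<omega>)) P"
    by (rule indep_vars_compose2[OF indep_vars_subset[OF indep P(2)]]) measurable
  have "integrable M (\<lambda>\<omega>. X p (z p \<omega>))" if "p \<in> P" for p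
  proof (rule integrable_const_bound[where B = 1])
    show "AE \<omega> in M. norm (X p (z p \<omega>)) \<le> 1"
      using AE_good by eventually_elim (use P that in \<open>auto simp: good_def X_def norm_mult norm_power\<close>)
    show "(\<lambda>\<omega>. X p (z p \<omega>)) \<in> borel_measurable M"
      using measurable_compose[OF z_measurable[of p], of "X p" borel] that P by auto
  qed
  then have "expectation (\<lambda>\<omega>. \<Prod>p\<in>P. X p (z p \<omega>)) = (\<Prod>p\<in>P. expectation (\<lambda>\<omega>. X p (z p \<omega>)))"
    by (intro indep_vars_lebesgue_integral P ind)
  also have "\<dots> = 0"
  proof -
    have "expectation (\<lambda>\<omega>. X q (z q \<omega>)) = (\<integral>w. X q w \<partial>distr M borel (z q))"
      using q P by (intro integral_distr[symmetric]) auto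
    also have "\<dots> = 0"
      using q P by (auto simp: distr_z X_def integral_uniform_circle_powers)
    finally show ?thesis using P q by (intro prod_zero) auto
  qed
  also have "(\<lambda>\<omega>. \<Prod>p\<in>P. X p (z p \<omega>)) = char_rand m n"
    by (simp add: char_rand_eq_prod[abs_def] P_def X_def)
  finally show ?thesis using False by simp
qed

text \<open>Both members are generated together with the same coefficients. A relation avoids having
  to show that a trigonometric polynomial in \<open>t\<close> determines its random
  counterpart.\<close>

inductive trig_pair :: "(real \<Rightarrow> complex) \<Rightarrow> ('a \<Rightarrow> complex) \<Rightarrow> bool" where
  monom: "m > 0 \<Longrightarrow> n > 0 \<Longrightarrow> trig_pair (\<lambda>t. c * char_flow m n t) (\<lambda>\<omega>. c * char_rand m n \<omega>)"
| add: "trig_pair f F \<Longrightarrow> trig_pair g G \<Longrightarrow> trig_pair (\<lambda>t. f t + g t) (\<lambda>\<omega>. F \<omega> + G \<omega>)"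

lemma char_mult:
  assumes "m > 0" "n > 0" "m' > 0" "n' > 0"
  shows "char_flow m n t * char_flow m' n' t = char_flow (m * m') (n * n') t"
    and "char_rand m n \<omega> * char_rand m' n' \<omega> = char_rand (m * m') (n * n') \<omega>"
  using assms
  by (simp_all add: char_flow_def char_rand_def steinhaus_def cis_mult ln_mult prime_factorization_mult
      algebra_simps)

lemma trig_pair_mult:
  assumes "trig_pair f F" "trig_pair g G"
  shows "trig_pair (\<lambda>t. f t * g t) (\<lambda>\<omega>. F \<omega> * G \<omega>)"
  using assms(1)
proof induction
  case (monom m n c)
  have shuffle: "(a * x) * (b * y) = (a * b) * (x * y)" for a b x y :: complex
    by (simp add: mult_ac)
  show ?case using assms(2)
  proof induction
    case (monom m' n' c')
    have "(\<lambda>t. (c * char_flow m n t) * (c' * char_flow m' n' t)) = (\<lambda>t. (c * c') * char_flow (m * m') (n * n') t)"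
      "(\<lambda>\<omega>. (c * char_rand m n \<omega>) * (c' * char_rand m' n' \<omega>)) = (\<lambda>\<omega>. (c * c') * char_rand (m * m') (n * n') \<omega>)"
      by (simp_all only: shuffle char_mult[OF \<open>m > 0\<close> \<open>n > 0\<close> monom])
    then show ?case
      using trig_pair.monom[of "m * m'" "n * n'" "c * c'"] monom \<open>m > 0\<close> \<open>n > 0\<close> by simp
  qed (simp only: distrib_left trig_pair.add)
qed (simp only: distrib_right trig_pair.add)

lemma trig_pair_cnj:
  assumes "trig_pair f F"
  shows "trig_pair (\<lambda>t. cnj (f t)) (\<lambda>\<omega>. cnj (F \<omega>))"
  using assms
proof induction
  case (monom m n c)
  have "(\<lambda>t. cnj (c * char_flow m n t)) = (\<lambda>t. cnj c * char_flow n m t)"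
    "(\<lambda>\<omega>. cnj (c * char_rand m n \<omega>)) = (\<lambda>\<omega>. cnj c * char_rand n m \<omega>)"
    by (simp_all add: char_flow_def char_rand_def cis_cnj algebra_simps)
  then show ?case using trig_pair.monom[of n m "cnj c"] monom by simp
qed (simp only: complex_cnj_add trig_pair.add)

lemma trig_pair_bounded:
  assumes "trig_pair f F"
  shows "\<exists>B. (\<forall>t. norm (f t) \<le> B) \<and> (\<forall>\<omega>\<in>good. norm (F \<omega>) \<le> B)"
  using assms
proof induction
  case (monom m n c)
  then show ?case
    by (intro exI[of _ "norm c"]) (auto simp: norm_mult norm_char_rand char_flow_def)
next
  case (add f F g G)
  then obtain B C where "\<forall>t. norm (f t) \<le> B" "\<forall>\<omega>\<in>good. norm (F \<omega>) \<le> B"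
    "\<forall>t. norm (g t) \<le> C" "\<forall>\<omega>\<in>good. norm (G \<omega>) \<le> C" by blast
  then show ?case
    by (intro exI[of _ "B + C"]) (auto intro!: norm_triangle_le add_mono)
qed

lemma trig_pair_measurable:
  assumes "trig_pair f F"
  shows "f \<in> borel_measurable borel" "F \<in> borel_measurable M"
  using assms
proof induction
  case (monom m n c)
  { case 1 show ?case unfolding char_flow_def by measurable }
  { case 2 show ?case by measurable }
qed auto

lemma integrable_of_bounds:
  fixes f :: "real \<Rightarrow> complex" and F :: "'a \<Rightarrow> complex"
  assumes "f \<in> borel_measurable borel" "F \<in> borel_measurable M"
    and "\<And>t. norm (f t) \<le> B" "\<And>\<omega>. \<omega> \<in> good \<Longrightarrow> norm (F \<omega>) \<le> B"
  shows "T > 0 \<Longrightarrow> integrable (unif_interval T) f" and "integrable M F"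
proof -
  show "integrable M F"
  proof (rule integrable_const_bound[where B = B])
    show "AE \<omega> in M. norm (F \<omega>) \<le> B"
      using AE_good by eventually_elim (rule assms)
  qed (rule assms)
  assume "T > 0"
  then interpret U: prob_space "unif_interval T" by (rule prob_space_unif_interval)
  show "integrable (unif_interval T) f"
    by (intro U.integrable_const_bound[where B = B]) (use assms in auto)
qed

lemma trig_pair_mean_tendsto:
  assumes "trig_pair f F"
  shows "((\<lambda>T. \<integral>t. f t \<partial>unif_interval T) \<longlongrightarrow> expectation F) at_top"
  using assms
proof induction
  case (monom m n c)
  \<comment> \<open>On the flow side the diagonal is singled out by injectivity of
    \<open>ln\<close>; on the random side unique factorization did the same. This match is what
    makes the means agree.\<close>
  have "(ln (real n) - ln (real m) = 0) = (m = n)" using monom by auto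
  then have "((\<lambda>T. c * (\<integral>t. char_flow m n t \<partial>unif_interval T)) \<longlongrightarrow> c * of_bool (m = n)) at_top"
    using tendsto_mult_left[OF mean_cis_tendsto[of "ln (real n) - ln (real m)"], of c]
    by (simp only: char_flow_def)
  then show ?case using monom expectation_char_rand[of m n] by simp
next
  case (add f F g G)
  obtain B where B: "\<And>t. norm (f t) \<le> B" "\<And>\<omega>. \<omega> \<in> good \<Longrightarrow> norm (F \<omega>) \<le> B"
    using trig_pair_bounded[OF add.hyps(1)] by blast
  obtain C where C: "\<And>t. norm (g t) \<le> C" "\<And>\<omega>. \<omega> \<in> good \<Longrightarrow> norm (G \<omega>) \<le> C"
    using trig_pair_bounded[OF add.hyps(2)] by blast
  note int = integrable_of_bounds[OF trig_pair_measurable[OF add.hyps(1)] B]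
    integrable_of_bounds[OF trig_pair_measurable[OF add.hyps(2)] C]
  have "\<forall>\<^sub>F T in at_top. (\<integral>t. f t \<partial>unif_interval T) + (\<integral>t. g t \<partial>unif_interval T) =
      (\<integral>t. f t + g t \<partial>unif_interval T)"
    using eventually_gt_at_top[of 0]
    by eventually_elim (use int in \<open>auto intro!: Bochner_Integration.integral_add[symmetric]\<close>)
  moreover have "expectation (\<lambda>\<omega>. F \<omega> + G \<omega>) = expectation F + expectation G"
    by (intro Bochner_Integration.integral_add int)
  ultimately show ?case
    using tendsto_add[OF add.IH] by (simp add: tendsto_cong)
qed

text \<open>
  The uniform closure of the pairs of trigonometric polynomials. It is closed under products and
  absolutely convergent series, hence under \<open>exp\<close>, while the means still agree in the limit.
\<close>
definition ap_pair :: "(real \<Rightarrow> complex) \<Rightarrow> ('a \<Rightarrow> complex) \<Rightarrow> bool" where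
  "ap_pair f F \<longleftrightarrow> (\<forall>e>0. \<exists>g G. trig_pair g G \<and>
     (\<forall>t. norm (f t - g t) \<le> e) \<and> (\<forall>\<omega>\<in>good. norm (F \<omega> - G \<omega>) \<le> e))"

section \<open>Closure properties of almost periodic pairs\<close>

lemma ap_pairE:
  assumes "ap_pair f F" "e > 0"
  obtains g G where "trig_pair g G" "\<And>t. norm (f t - g t) \<le> e"
    "\<And>\<omega>. \<omega> \<in> good \<Longrightarrow> norm (F \<omega> - G \<omega>) \<le> e"
  using assms unfolding ap_pair_def by blast

lemma trig_imp_ap_pair: "trig_pair f F \<Longrightarrow> ap_pair f F"
  unfolding ap_pair_def by (intro allI impI exI[of _ f] exI[of _ F]) auto

lemma ap_pair_cong:
  assumes "ap_pair f F" "\<And>t. f t = g t" "\<And>\<omega>. \<omega> \<in> good \<Longrightarrow> F \<omega> = G \<omega>"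
  shows "ap_pair g G"
  using assms unfolding ap_pair_def by simp

lemma ap_pair_bounded:
  assumes "ap_pair f F"
  obtains B where "B > 0" "\<And>t. norm (f t) \<le> B" "\<And>\<omega>. \<omega> \<in> good \<Longrightarrow> norm (F \<omega>) \<le> B"
proof -
  obtain g G where g: "trig_pair g G" "\<And>t. norm (f t - g t) \<le> 1"
    "\<And>\<omega>. \<omega> \<in> good \<Longrightarrow> norm (F \<omega> - G \<omega>) \<le> 1"
    using ap_pairE[OF assms zero_less_one] by blast
  obtain B where B: "\<And>t. norm (g t) \<le> B" "\<And>\<omega>. \<omega> \<in> good \<Longrightarrow> norm (G \<omega>) \<le> B"
    using trig_pair_bounded[OF g(1)] by blast
  have "B \<ge> 0" using B(1)[of 0] norm_ge_zero order_trans by blast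
  show thesis
  proof (rule that[of "B + 1"])
    show "norm (f t) \<le> B + 1" for t
      using norm_triangle_ineq[of "g t" "f t - g t"] B(1)[of t] g(2)[of t] by simp
    show "norm (F \<omega>) \<le> B + 1" if "\<omega> \<in> good" for \<omega>
      using norm_triangle_ineq[of "G \<omega>" "F \<omega> - G \<omega>"] B(2)[OF that] g(3)[OF that] by simp
  qed (use \<open>B \<ge> 0\<close> in simp)
qed

lemma ap_pair_const: "ap_pair (\<lambda>_. c) (\<lambda>_. c)"
proof -
  have "trig_pair (\<lambda>t. c * char_flow 1 1 t) (\<lambda>\<omega>. c * char_rand 1 1 \<omega>)" by (rule monom) auto
  then show ?thesis by (intro trig_imp_ap_pair) (simp add: char_flow_def char_rand_def steinhaus_def)
qed

lemma ap_pair_prime: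
  assumes "prime p"
  shows "ap_pair (prime_flow p) (z p)"
proof -
  have "trig_pair (\<lambda>t. 1 * char_flow p 1 t) (\<lambda>\<omega>. 1 * char_rand p 1 \<omega>)"
    by (rule monom) (use assms prime_gt_0_nat in auto)
  moreover have "(\<lambda>t. 1 * char_flow p 1 t) = prime_flow p" "(\<lambda>\<omega>. 1 * char_rand p 1 \<omega>) = z p"
    using assms by (simp_all add: fun_eq_iff char_flow_def prime_flow_def char_rand_def steinhaus_def
        prime_factorization_prime mult.commute)
  ultimately show ?thesis by (metis trig_imp_ap_pair)
qed

lemma ap_pair_cnj:
  assumes "ap_pair f F"
  shows "ap_pair (\<lambda>t. cnj (f t)) (\<lambda>\<omega>. cnj (F \<omega>))"
  unfolding ap_pair_def
proof (intro allI impI)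
  fix e :: real assume "e > 0"
  from ap_pairE[OF assms this] obtain g G where g: "trig_pair g G" "\<And>t. norm (f t - g t) \<le> e"
    "\<And>\<omega>. \<omega> \<in> good \<Longrightarrow> norm (F \<omega> - G \<omega>) \<le> e" by blast
  then show "\<exists>g G. trig_pair g G \<and> (\<forall>t. norm (cnj (f t) - g t) \<le> e) \<and> (\<forall>\<omega>\<in>good. norm (cnj (F \<omega>) - G \<omega>) \<le> e)"
    by (intro exI[of _ "\<lambda>t. cnj (g t)"] exI[of _ "\<lambda>\<omega>. cnj (G \<omega>)"])
       (auto simp: trig_pair_cnj simp flip: complex_cnj_diff)
qed

lemma ap_pair_add:
  assumes "ap_pair f F" "ap_pair g G"
  shows "ap_pair (\<lambda>t. f t + g t) (\<lambda>\<omega>. F \<omega> + G \<omega>)"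
  unfolding ap_pair_def
proof (intro allI impI)
  fix e :: real assume "e > 0"
  then have e: "e / 2 > 0" by simp
  obtain f' F' where f: "trig_pair f' F'" "\<And>t. norm (f t - f' t) \<le> e / 2"
    "\<And>\<omega>. \<omega> \<in> good \<Longrightarrow> norm (F \<omega> - F' \<omega>) \<le> e / 2" using ap_pairE[OF assms(1) e] by blast
  obtain g' G' where g: "trig_pair g' G'" "\<And>t. norm (g t - g' t) \<le> e / 2"
    "\<And>\<omega>. \<omega> \<in> good \<Longrightarrow> norm (G \<omega> - G' \<omega>) \<le> e / 2" using ap_pairE[OF assms(2) e] by blast
  have "norm (f t + g t - (f' t + g' t)) \<le> e" for t
    using norm_diff_triangle_ineq[of "f t" "g t" "f' t" "g' t"] f(2)[of t] g(2)[of t] by simp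
  moreover have "norm (F \<omega> + G \<omega> - (F' \<omega> + G' \<omega>)) \<le> e" if "\<omega> \<in> good" for \<omega>
    using norm_diff_triangle_ineq[of "F \<omega>" "G \<omega>" "F' \<omega>" "G' \<omega>"] f(3)[OF that] g(3)[OF that] by simp
  ultimately show "\<exists>h H. trig_pair h H \<and> (\<forall>t. norm (f t + g t - h t) \<le> e) \<and> (\<forall>\<omega>\<in>good. norm (F \<omega> + G \<omega> - H \<omega>) \<le> e)"
    using trig_pair.add[OF f(1) g(1)] by blast
qed

lemma ap_pair_mult:
  assumes "ap_pair f F" "ap_pair g G"
  shows "ap_pair (\<lambda>t. f t * g t) (\<lambda>\<omega>. F \<omega> * G \<omega>)"
  unfolding ap_pair_def
proof (intro allI impI)
  fix e :: real assume e: "e > 0"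
  obtain B where B: "B > 0" "\<And>t. norm (f t) \<le> B" "\<And>\<omega>. \<omega> \<in> good \<Longrightarrow> norm (F \<omega>) \<le> B"
    using ap_pair_bounded[OF assms(1)] by blast
  obtain g' G' where g: "trig_pair g' G'" "\<And>t. norm (g t - g' t) \<le> e / (2 * B)"
    "\<And>\<omega>. \<omega> \<in> good \<Longrightarrow> norm (G \<omega> - G' \<omega>) \<le> e / (2 * B)"
    using ap_pairE[OF assms(2), of "e / (2 * B)"] e B by auto
  \<comment> \<open>\<open>C\<close> bounds the approximant \<open>g'\<close>, not \<open>g\<close>,
    because the error is split as \<open>a * (b - b') + (a - a') * b'\<close>. Hence
    \<open>f'\<close> can only be chosen after \<open>g'\<close>.\<close>
  obtain C where C: "C > 0" "\<And>t. norm (g' t) \<le> C" "\<And>\<omega>. \<omega> \<in> good \<Longrightarrow> norm (G' \<omega>) \<le> C"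
    using ap_pair_bounded[OF trig_imp_ap_pair[OF g(1)]] by blast
  obtain f' F' where f: "trig_pair f' F'" "\<And>t. norm (f t - f' t) \<le> e / (2 * C)"
    "\<And>\<omega>. \<omega> \<in> good \<Longrightarrow> norm (F \<omega> - F' \<omega>) \<le> e / (2 * C)"
    using ap_pairE[OF assms(1), of "e / (2 * C)"] e C by auto
  have *: "norm (a * b - a' * b') \<le> e"
    if "norm a \<le> B" "norm b' \<le> C" "norm (a - a') \<le> e / (2 * C)" "norm (b - b') \<le> e / (2 * B)"
    for a b a' b' :: complex
  proof -
    have "a * b - a' * b' = a * (b - b') + (a - a') * b'" by (simp add: algebra_simps)
    also have "norm \<dots> \<le> norm a * norm (b - b') + norm (a - a') * norm b'"
      by (metis norm_mult norm_triangle_ineq)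
    also have "\<dots> \<le> B * (e / (2 * B)) + e / (2 * C) * C"
      using that B(1) C(1) e by (intro add_mono mult_mono) auto
    also have "\<dots> = e" using B(1) C(1) by simp
    finally show ?thesis .
  qed
  have "\<forall>t. norm (f t * g t - f' t * g' t) \<le> e" using B C f g by (auto intro!: *)
  moreover have "\<forall>\<omega>\<in>good. norm (F \<omega> * G \<omega> - F' \<omega> * G' \<omega>) \<le> e" using B C f g by (auto intro!: *)
  ultimately show "\<exists>h H. trig_pair h H \<and> (\<forall>t. norm (f t * g t - h t) \<le> e) \<and> (\<forall>\<omega>\<in>good. norm (F \<omega> * G \<omega> - H \<omega>) \<le> e)"
    using trig_pair_mult[OF f(1) g(1)] by blast
qed

lemma ap_pair_power: "ap_pair f F \<Longrightarrow> ap_pair (\<lambda>t. f t ^ n) (\<lambda>\<omega>. F \<omega> ^ n)"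
  by (induction n) (auto intro: ap_pair_const ap_pair_mult)

lemma ap_pair_sum:
  fixes f :: "nat \<Rightarrow> real \<Rightarrow> complex"
  shows "(\<And>k. ap_pair (f k) (F k)) \<Longrightarrow> ap_pair (\<lambda>t. \<Sum>k<n. f k t) (\<lambda>\<omega>. \<Sum>k<n. F k \<omega>)"
  by (induction n) (auto intro: ap_pair_const ap_pair_add)

text \<open>The same majorant \<open>B\<close> dominates both series, so one truncation index works
  for the flow and the random side at once.\<close>

lemma ap_pair_suminf:
  fixes f :: "nat \<Rightarrow> real \<Rightarrow> complex"
  assumes ap: "\<And>k. ap_pair (f k) (F k)" and "summable B"
    and "\<And>k t. norm (f k t) \<le> B k" "\<And>k \<omega>. \<omega> \<in> good \<Longrightarrow> norm (F k \<omega>) \<le> B k"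
  shows "ap_pair (\<lambda>t. \<Sum>k. f k t) (\<lambda>\<omega>. \<Sum>k. F k \<omega>)"
  unfolding ap_pair_def
proof (intro allI impI)
  fix e :: real assume e: "e > 0"
  have "uniform_limit UNIV (\<lambda>n t. \<Sum>k<n. f k t) (\<lambda>t. \<Sum>k. f k t) sequentially"
    "uniform_limit good (\<lambda>n \<omega>. \<Sum>k<n. F k \<omega>) (\<lambda>\<omega>. \<Sum>k. F k \<omega>) sequentially"
    by (rule Weierstrass_m_test; use assms in auto)+
  then have "\<forall>\<^sub>F n in sequentially. (\<forall>t\<in>UNIV. dist (\<Sum>k<n. f k t) (\<Sum>k. f k t) < e / 2) \<and>
      (\<forall>\<omega>\<in>good. dist (\<Sum>k<n. F k \<omega>) (\<Sum>k. F k \<omega>) < e / 2)"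
    using e by (intro eventually_conj) (auto dest!: uniform_limitD[where e = "e / 2"])
  then obtain n where n: "\<And>t. dist (\<Sum>k<n. f k t) (\<Sum>k. f k t) < e / 2"
      "\<And>\<omega>. \<omega> \<in> good \<Longrightarrow> dist (\<Sum>k<n. F k \<omega>) (\<Sum>k. F k \<omega>) < e / 2"
    by (auto simp: eventually_sequentially)
  have "ap_pair (\<lambda>t. \<Sum>k<n. f k t) (\<lambda>\<omega>. \<Sum>k<n. F k \<omega>)" by (intro ap_pair_sum ap)
  from ap_pairE[OF this, of "e / 2"] e obtain g G where g: "trig_pair g G"
    "\<And>t. norm ((\<Sum>k<n. f k t) - g t) \<le> e / 2"
    "\<And>\<omega>. \<omega> \<in> good \<Longrightarrow> norm ((\<Sum>k<n. F k \<omega>) - G \<omega>) \<le> e / 2" by auto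
  have "norm ((\<Sum>k. f k t) - g t) \<le> e" for t
    using dist_triangle[of "\<Sum>k. f k t" "g t" "\<Sum>k<n. f k t"] n(1)[of t] g(2)[of t]
    by (simp add: dist_norm norm_minus_commute)
  moreover have "norm ((\<Sum>k. F k \<omega>) - G \<omega>) \<le> e" if "\<omega> \<in> good" for \<omega>
    using dist_triangle[of "\<Sum>k. F k \<omega>" "G \<omega>" "\<Sum>k<n. F k \<omega>"] n(2)[OF that] g(3)[OF that]
    by (simp add: dist_norm norm_minus_commute)
  ultimately show "\<exists>g G. trig_pair g G \<and> (\<forall>t. norm ((\<Sum>k. f k t) - g t) \<le> e) \<and>
      (\<forall>\<omega>\<in>good. norm ((\<Sum>k. F k \<omega>) - G \<omega>) \<le> e)"
    using g(1) by blast
qed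

lemma ap_pair_exp:
  assumes "ap_pair f F"
  shows "ap_pair (\<lambda>t. exp (f t)) (\<lambda>\<omega>. exp (F \<omega>))"
proof -
  obtain B where B: "B > 0" "\<And>t. norm (f t) \<le> B" "\<And>\<omega>. \<omega> \<in> good \<Longrightarrow> norm (F \<omega>) \<le> B"
    using ap_pair_bounded[OF assms] by blast
  have bd: "norm (of_real (inverse (fact n)) * w ^ n) \<le> inverse (fact n) * B ^ n"
    if "norm w \<le> B" for n and w :: complex
    using that B(1) unfolding norm_mult norm_power norm_of_real
    by (intro mult_mono power_mono) auto
  have "ap_pair (\<lambda>t. \<Sum>n. of_real (inverse (fact n)) * f t ^ n) (\<lambda>\<omega>. \<Sum>n. of_real (inverse (fact n)) * F \<omega> ^ n)"
  proof (rule ap_pair_suminf)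
    show "summable (\<lambda>n. inverse (fact n) * B ^ n)" by (rule summable_exp)
  qed (use B assms in \<open>auto intro!: bd ap_pair_mult ap_pair_const ap_pair_power simp del: of_real_inverse\<close>)
  then show ?thesis by (simp add: exp_def scaleR_conv_of_real)
qed

text \<open>Since \<open>r \<le> 1 / 2\<close>, the logarithmic series in \<open>r * w\<close> has a
  geometric majorant on the whole circle, which makes it a uniform limit of polynomials in
  \<open>w\<close>.\<close>

lemma ap_pair_euler_summand:
  assumes "\<sigma> > 1"
  shows "ap_pair (\<lambda>t. euler_summand \<sigma> p (prime_flow p t)) (\<lambda>\<omega>. euler_summand \<sigma> p (z p \<omega>))"
proof (cases "prime p")
  case True
  define r where "r = real p powr - \<sigma>"
  have r: "0 \<le> r" "r \<le> 1 / 2" using prime_powr_minus_le[OF assms True] by (auto simp: r_def)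
  \<comment> \<open>The term at \<open>k = 0\<close> vanishes because division by zero yields 0, so
    the series may start there.\<close>
  have ser: "(\<Sum>k. of_real (r ^ k / real k) * w ^ k) = euler_summand \<sigma> p w" if "norm w = 1" for w
  proof -
    have "norm (of_real r * w) < 1" using r that by (simp add: norm_mult)
    then have "(\<lambda>n. - ((of_real r * w) ^ n) / of_nat n) sums Ln (1 - of_real r * w)"
      using Ln_series'[of "- (of_real r * w)"] by simp
    from sums_minus[OF this] have "(\<lambda>k. of_real (r ^ k / real k) * w ^ k) sums - Ln (1 - of_real r * w)"
      by (simp add: power_mult_distrib)
    then show ?thesis using True by (simp add: euler_summand_def r_def sums_iff)
  qed
  have "ap_pair (\<lambda>t. \<Sum>k. of_real (r ^ k / real k) * prime_flow p t ^ k) (\<lambda>\<omega>. \<Sum>k. of_real (r ^ k / real k) * z p \<omega> ^ k)"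
  proof (rule ap_pair_suminf)
    show "summable (\<lambda>k. r ^ k)" using r by (intro summable_geometric) auto
    have bd: "\<bar>r ^ k / real k\<bar> \<le> r ^ k" for k
    proof (cases "k = 0")
      case False
      then have "r ^ k / real k \<le> r ^ k / 1" using r by (intro divide_left_mono) auto
      then show ?thesis using r by (simp add: abs_divide)
    qed simp
    show "norm (of_real (r ^ k / real k) * prime_flow p t ^ k) \<le> r ^ k" for k t
      using bd[of k] unfolding norm_mult norm_of_real norm_power by simp
    show "norm (of_real (r ^ k / real k) * z p \<omega> ^ k) \<le> r ^ k" if "\<omega> \<in> good" for k \<omega>
      using bd[of k] that True unfolding norm_mult norm_of_real norm_power by (simp add: good_def)
  qed (intro ap_pair_mult ap_pair_const ap_pair_power ap_pair_prime True)
  then show ?thesis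
    by (rule ap_pair_cong) (use ser True in \<open>auto simp: good_def\<close>)
qed (simp add: euler_summand_def ap_pair_const)

lemma ap_pair_random_log_euler:
  assumes "\<sigma> > 1"
  shows "ap_pair (random_log_euler prime_flow \<sigma>) (random_log_euler z \<sigma>)"
proof -
  have "ap_pair (\<lambda>t. \<Sum>p. euler_summand \<sigma> p (prime_flow p t)) (\<lambda>\<omega>. \<Sum>p. euler_summand \<sigma> p (z p \<omega>))"
    by (rule ap_pair_suminf[OF ap_pair_euler_summand[OF assms] summable_mult[OF summable_nat_powr_minus[OF assms], of 2]])
       (use norm_euler_summand_le[OF assms] in \<open>auto simp: good_def\<close>)
  then show ?thesis
    by (rule ap_pair_cong)
       (auto intro!: sums_unique[symmetric] euler_summand_sums(2)[OF assms] simp: good_def)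
qed

text \<open>Replacing \<open>f\<close> by \<open>g\<close> costs at most \<open>e / 4\<close> in the
  mean for every \<open>T > 0\<close> simultaneously. This uniformity in \<open>T\<close> lets the
  limit for trigonometric polynomials carry over.\<close>

lemma ap_pair_mean_tendsto:
  assumes ap: "ap_pair f F" and [measurable]: "f \<in> borel_measurable borel" "F \<in> borel_measurable M"
  shows "((\<lambda>T. \<integral>t. f t \<partial>unif_interval T) \<longlongrightarrow> expectation F) at_top"
proof (rule tendstoI)
  fix e :: real assume e: "e > 0"
  obtain g G where g: "trig_pair g G" "\<And>t. norm (f t - g t) \<le> e / 4"
    "\<And>\<omega>. \<omega> \<in> good \<Longrightarrow> norm (F \<omega> - G \<omega>) \<le> e / 4"
    using ap_pairE[OF ap, of "e / 4"] e by auto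
  have [measurable]: "g \<in> borel_measurable borel" "G \<in> borel_measurable M"
    using trig_pair_measurable[OF g(1)] by auto
  obtain B where "B > 0" and B: "\<And>t. norm (f t) \<le> B" "\<And>\<omega>. \<omega> \<in> good \<Longrightarrow> norm (F \<omega>) \<le> B"
    using ap_pair_bounded[OF ap] by blast
  obtain C where C: "\<And>t. norm (g t) \<le> C" "\<And>\<omega>. \<omega> \<in> good \<Longrightarrow> norm (G \<omega>) \<le> C"
    using trig_pair_bounded[OF g(1)] by blast
  note int = integrable_of_bounds[OF assms(2,3) B] integrable_of_bounds[OF trig_pair_measurable[OF g(1)] C]
  have 1: "norm (expectation F - expectation G) \<le> e / 4"
  proof -
    have "norm (expectation (\<lambda>\<omega>. F \<omega> - G \<omega>)) \<le> expectation (\<lambda>\<omega>. norm (F \<omega> - G \<omega>))"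
      by (rule integral_norm_bound)
    also have "\<dots> \<le> expectation (\<lambda>\<omega>. e / 4)"
      using int AE_good g(3) by (intro integral_mono_AE) (auto elim!: eventually_mono)
    finally show ?thesis using int prob_space by simp
  qed
  have "\<forall>\<^sub>F T in at_top. dist (\<integral>t. g t \<partial>unif_interval T) (expectation G) < e / 4"
    using trig_pair_mean_tendsto[OF g(1)] e by (intro tendstoD) auto
  then show "\<forall>\<^sub>F T in at_top. dist (\<integral>t. f t \<partial>unif_interval T) (expectation F) < e"
    using eventually_gt_at_top[of 0]
  proof eventually_elim
    case (elim T)
    then interpret U: prob_space "unif_interval T" by (intro prob_space_unif_interval)
    have "norm ((\<integral>t. f t - g t \<partial>unif_interval T)) \<le> (\<integral>t. norm (f t - g t) \<partial>unif_interval T)"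
      by (rule integral_norm_bound)
    also have "\<dots> \<le> (\<integral>t. e / 4 \<partial>unif_interval T)"
      using int elim g(2) by (intro integral_mono) auto
    finally have "norm ((\<integral>t. f t \<partial>unif_interval T) - (\<integral>t. g t \<partial>unif_interval T)) \<le> e / 4"
      using int elim U.prob_space by simp
    then show ?case using 1 elim(1) e
      dist_triangle[of "\<integral>t. f t \<partial>unif_interval T" "expectation F" "\<integral>t. g t \<partial>unif_interval T"]
      dist_triangle[of "\<integral>t. g t \<partial>unif_interval T" "expectation F" "expectation G"]
      by (simp add: dist_norm norm_minus_commute)
  qed
qed

end

section \<open>The distribution of the argument\<close>

text \<open>\<open>1 - w\<close> runs over the circle of radius \<open>r\<close> about 1. Seen from
  the origin, this circle extends up to its two tangents, which make the angle
  \<open>arcsin r\<close> with the real axis.\<close>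

lemma abs_Im_Ln_one_minus_le_arcsin:
  assumes w: "norm w = r" and r: "r < 1"
  shows "\<bar>Im (Ln (1 - w))\<bar> \<le> arcsin r"
proof -
  define v where "v = 1 - w"
  have r0: "0 \<le> r" using w by auto
  have "Re w \<le> r" using w complex_Re_le_cmod[of w] by simp
  then have re: "Re v > 0" using r by (simp add: v_def)
  have v0: "v \<noteq> 0" using re by auto
  have bnd: "\<bar>Im (Ln v)\<bar> < pi / 2" using Re_Ln_pos_lt[OF v0] re by blast
  have sin: "sin (Im (Ln v)) = Im v / norm v"
  proof -
    have "v = exp (Ln v)" using v0 by simp
    then have "Im v = exp (Re (Ln v)) * sin (Im (Ln v))" by (metis Im_exp)
    moreover have "exp (Re (Ln v)) = norm v" using v0 by (simp add: Re_Ln)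
    ultimately show ?thesis using v0 by simp
  qed
  have "(Im v)\<^sup>2 \<le> (r * norm v)\<^sup>2"
  proof -
    have "r\<^sup>2 = (Re w)\<^sup>2 + (Im w)\<^sup>2" using w by (simp add: cmod_power2 [symmetric])
    \<comment> \<open>The deficit is a perfect square; it vanishes exactly at the points of
      tangency, where \<open>Re w\<close> equals the square of \<open>r\<close>.\<close>
    then have "(r * norm v)\<^sup>2 - (Im v)\<^sup>2 = (r\<^sup>2 - Re w)\<^sup>2"
      by (simp add: power_mult_distrib cmod_power2 v_def) (simp add: power2_eq_square algebra_simps)
    then show ?thesis using zero_le_power2[of "r\<^sup>2 - Re w"] by linarith
  qed
  then have "\<bar>Im v\<bar> \<le> r * norm v"
    using r0 by (metis abs_le_square_iff abs_mult abs_norm_cancel abs_of_nonneg)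
  then have s: "\<bar>sin (Im (Ln v))\<bar> \<le> r"
    using v0 unfolding sin by (simp add: abs_divide divide_le_eq)
  have "\<bar>Im (Ln v)\<bar> = arcsin (sin \<bar>Im (Ln v)\<bar>)"
    using bnd by (intro arcsin_sin [symmetric]) auto
  also have "sin \<bar>Im (Ln v)\<bar> = \<bar>sin (Im (Ln v))\<bar>"
    using bnd sin_ge_zero[of "\<bar>Im (Ln v)\<bar>"] by (auto simp: abs_if split: if_splits)
  also have "arcsin \<dots> \<le> arcsin r"
    using s r by (intro arcsin_le_arcsin) auto
  finally show ?thesis by (simp add: v_def)
qed

text \<open>A crude bound via \<open>x \<le> tan x\<close>, which makes the arcsine sum over the
  primes comparable with the sum of \<open>p powr - \<sigma>\<close>.\<close>

lemma arcsin_le_double: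
  assumes "0 \<le> r" "r \<le> 1 / 2"
  shows "arcsin r \<le> 2 * r"
proof -
  have lt: "\<bar>arcsin r\<bar> < pi / 2" using assms arcsin_lt_bounded[of r] by auto
  have "0 \<le> arcsin r" using assms arcsin_le_arcsin[of 0 r] by simp
  then have "arcsin r \<le> \<bar>tan (arcsin r)\<bar>" using abs_tan_ge[OF lt] by simp
  also have "tan (arcsin r) = r / sqrt (1 - r\<^sup>2)" using assms by (simp add: tan_def cos_arcsin)
  also have "\<bar>r / sqrt (1 - r\<^sup>2)\<bar> \<le> r / (1 / 2)"
  proof -
    have "r\<^sup>2 \<le> (1 / 2)\<^sup>2" using assms by (intro power_mono) auto
    then have "(1 / 2)\<^sup>2 \<le> 1 - r\<^sup>2" by (simp add: power2_eq_square)
    then have "1 / 2 \<le> sqrt (1 - r\<^sup>2)" by (rule real_le_rsqrt)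
    then have "r / sqrt (1 - r\<^sup>2) \<le> r / (1 / 2)"
      using assms by (intro frac_le) auto
    moreover have "0 \<le> r / sqrt (1 - r\<^sup>2)"
      using assms \<open>1 / 2 \<le> sqrt (1 - r\<^sup>2)\<close> by (intro divide_nonneg_nonneg) linarith+
    ultimately show ?thesis by (simp only: abs_of_nonneg)
  qed
  finally show ?thesis by simp
qed

section \<open>Absence of atoms and the arcsine bound\<close>

lemma countable_sin_eq: "countable {x :: real. sin x = k}"
proof (cases "\<exists>y. sin y = k")
  case True
  then obtain y where y: "sin y = k" by blast
  have "{x. sin x = k} \<subseteq> (\<lambda>n::int. y + 2 * of_int n * pi) ` UNIV \<union> (\<lambda>n::int. - y + (2 * of_int n + 1) * pi) ` UNIV"
  proof
    fix x assume "x \<in> {x. sin x = k}"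
    then have "sin x = sin y" using y by simp
    then show "x \<in> (\<lambda>n::int. y + 2 * of_int n * pi) ` UNIV \<union> (\<lambda>n::int. - y + (2 * of_int n + 1) * pi) ` UNIV"
      unfolding sin_eq by (auto elim!: Ints_cases)
  qed
  then show ?thesis by (rule countable_subset) auto
qed auto

text \<open>If \<open>1 - r * cis t\<close> has argument \<open>c\<close>, rotating it by
  \<open>- c\<close> makes it real. Its imaginary part then gives
  \<open>sin c + r * sin (t - c) = 0\<close>, which only countably many \<open>t\<close>
  satisfy.\<close>

lemma AE_uniform_circle_Im_Ln_neq:
  assumes "0 < r" "r < 1"
  shows "AE w in uniform_circle. Im (Ln (1 - of_real r * w)) \<noteq> c"
proof -
  have "{t. Im (Ln (1 - of_real r * cis t)) = c} \<subseteq> (\<lambda>x. x + c) ` {x. sin x = - sin c / r}"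
  proof
    fix t assume "t \<in> {t. Im (Ln (1 - of_real r * cis t)) = c}"
    then have t: "Im (Ln (1 - of_real r * cis t)) = c" by simp
    define v where "v = 1 - of_real r * cis t"
    have "norm (of_real r * cis t) < 1" using assms by (simp add: norm_mult)
    then have "v \<noteq> 0" by (auto simp: v_def)
    then have "v = exp (Ln v)" by simp
    also have "\<dots> = of_real (exp (Re (Ln v))) * cis c"
      using t by (simp add: exp_eq_polar v_def)
    finally have "v * cis (- c) = of_real (exp (Re (Ln v)))"
      by (metis cis_mult cis_zero mult.assoc mult.right_neutral right_minus)
    then have "Im (v * cis (- c)) = 0" by (metis Im_complex_of_real)
    then have "sin c + r * sin (t - c) = 0"
      by (simp add: v_def sin_diff algebra_simps)
    then have "sin (t - c) = - sin c / r" using assms by (simp add: field_simps)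
    then show "t \<in> (\<lambda>x. x + c) ` {x. sin x = - sin c / r}"
      by (intro image_eqI[of _ _ "t - c"]) auto
  qed
  then have "countable {t. Im (Ln (1 - of_real r * cis t)) = c}"
    by (rule countable_subset) (intro countable_image countable_sin_eq)
  then have "AE t in lborel. Im (Ln (1 - of_real r * cis t)) \<noteq> c"
    by (intro AE_I'[OF countable_imp_null_set_lborel]) auto
  then have "AE t in uniform_measure lborel {0..<2 * pi}. Im (Ln (1 - of_real r * cis t)) \<noteq> c"
    by (intro AE_uniform_measureI) (auto elim: eventually_mono)
  then show ?thesis
    unfolding uniform_circle_def by (subst AE_distr_iff) auto
qed

lemma arcsin_prime_sums:
  assumes "\<sigma> > 1"
  shows "(\<lambda>p. if prime p then arcsin (real p powr - \<sigma>) else 0) sums arcsin_prime_sum \<sigma>"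
proof -
  define f where "f p = (if prime p then arcsin (real p powr - \<sigma>) else 0)" for p :: nat
  have nn: "0 \<le> arcsin (real p powr - \<sigma>)" if "prime p" for p
    using prime_powr_minus_le[OF assms that] arcsin_le_arcsin[of 0 "real p powr - \<sigma>"] by simp
  have summ: "summable (\<lambda>p. norm (f p))"
    by (rule summable_comparison_test'[OF summable_mult[OF summable_nat_powr_minus[OF assms]], of 0 _ 2])
       (use nn arcsin_le_double prime_powr_minus_le[OF assms] in \<open>auto simp: f_def\<close>)
  have "arcsin_prime_sum \<sigma> = infsum f UNIV"
    unfolding arcsin_prime_sum_def by (rule infsum_cong_neutral) (auto simp: f_def)
  also have "\<dots> = suminf f"
    using summ by (intro infsumI norm_summable_imp_has_sum summable_sums) (auto intro: summable_norm_cancel)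
  finally show ?thesis
    using summable_sums[OF summable_norm_cancel[OF summ]] by (simp add: f_def[abs_def])
qed

lemma abs_Im_random_log_euler_le:
  assumes "\<sigma> > 1" "\<And>p. prime p \<Longrightarrow> norm (z p \<omega>) = 1"
  shows "\<bar>Im (random_log_euler z \<sigma> \<omega>)\<bar> \<le> arcsin_prime_sum \<sigma>"
proof -
  note S = sums_Im[OF euler_summand_sums(2)[where z = z and \<omega> = \<omega>, OF assms]]
  note A = arcsin_prime_sums[OF assms(1)]
  have "\<bar>suminf (\<lambda>p. Im (euler_summand \<sigma> p (z p \<omega>)))\<bar> \<le>
      suminf (\<lambda>p. if prime p then arcsin (real p powr - \<sigma>) else 0)"
  proof (rule norm_suminf_le[where 'a = real, simplified real_norm_def])
    fix p
    show "\<bar>Im (euler_summand \<sigma> p (z p \<omega>))\<bar> \<le> (if prime p then arcsin (real p powr - \<sigma>) else 0)"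
      using prime_powr_minus_le[OF assms(1), of p] assms(2)[of p]
      by (auto simp: euler_summand_def norm_mult intro!: abs_Im_Ln_one_minus_le_arcsin)
  qed (use A in \<open>simp add: sums_iff\<close>)
  then show ?thesis using S A by (simp add: sums_iff)
qed

lemma euler_summand_measurable [measurable]: "euler_summand \<sigma> p \<in> borel_measurable borel"
  unfolding euler_summand_def by (cases "prime p") auto

context random_euler
begin

lemma random_log_euler_measurable [measurable]: "random_log_euler z \<sigma> \<in> borel_measurable M"
proof -
  have "(\<lambda>\<omega>. if prime p then Ln (1 - of_real (real p powr (- \<sigma>)) * z p \<omega>) else 0) \<in> borel_measurable M" for p
  proof (cases "prime p")
    case True
    then have [measurable]: "z p \<in> borel_measurable M" by (rule z_measurable)
    show ?thesis by measurable
  qed simp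
  then show ?thesis unfolding random_log_euler_def
    by (intro borel_measurable_uminus borel_measurable_suminf)
qed

text \<open>
  The factor at the prime 2 has no atoms and is independent of the other factors, so \<open>Im S\<close> has no
  atoms either.
\<close>
lemma AE_Im_random_log_euler_neq:
  assumes \<sigma>: "\<sigma> > 1"
  shows "AE \<omega> in M. Im (random_log_euler z \<sigma> \<omega>) \<noteq> c"
proof -
  define B where "B = {p::nat. prime p} - {2}"
  \<comment> \<open>The sum over the odd primes, as a measurable function on the product space over
    \<open>B\<close>: independence of the coordinates in \<open>{2}\<close> from those in
    \<open>B\<close> then passes to \<open>z 2\<close> and this remainder.\<close>
  define R where "R f = (\<Sum>p. if p \<in> B then euler_summand \<sigma> p (f p) else 0)" for f :: "nat \<Rightarrow> complex"
  have comp: "(\<lambda>f. f p) \<in> borel_measurable (Pi\<^sub>M I (\<lambda>_. borel :: complex measure))" if "p \<in> I" for p I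
    using measurable_component_singleton[OF that, of "\<lambda>_. borel :: complex measure"] by simp
  have Rm: "R \<in> borel_measurable (Pi\<^sub>M B (\<lambda>_. borel))"
    unfolding R_def
  proof (rule borel_measurable_suminf)
    show "(\<lambda>f. if p \<in> B then euler_summand \<sigma> p (f p) else 0) \<in> borel_measurable (Pi\<^sub>M B (\<lambda>_. borel))" for p
      by (cases "p \<in> B") (auto intro!: measurable_compose[OF comp])
  qed
  have "indep_var borel ((\<lambda>f. f 2) \<circ> (\<lambda>\<omega>. restrict (\<lambda>i. z i \<omega>) {2})) borel (R \<circ> (\<lambda>\<omega>. restrict (\<lambda>i. z i \<omega>) B))"
    by (rule indep_var_compose[OF indep_var_restrict[OF indep] comp Rm]) (auto simp: B_def)
  moreover have "(\<lambda>f. f 2) \<circ> (\<lambda>\<omega>. restrict (\<lambda>i. z i \<omega>) {2}) = z 2" by auto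
  ultimately have ind: "indep_var borel (z 2) borel (R \<circ> (\<lambda>\<omega>. restrict (\<lambda>i. z i \<omega>) B))" by simp
  define Q where "Q \<omega> = R (restrict (\<lambda>i. z i \<omega>) B)" for \<omega>
  have "R \<circ> (\<lambda>\<omega>. restrict (\<lambda>i. z i \<omega>) B) = Q" by (auto simp: Q_def)
  with ind have Q: "indep_var borel (z 2) borel Q" by simp
  have [measurable]: "z 2 \<in> borel_measurable M" "Q \<in> borel_measurable M"
    using indep_var_rv1[OF Q] indep_var_rv2[OF Q] by auto
  have dist: "distr M borel (z 2) \<Otimes>\<^sub>M distr M borel Q = distr M (borel \<Otimes>\<^sub>M borel) (\<lambda>\<omega>. (z 2 \<omega>, Q \<omega>))"
    using Q by (simp add: indep_var_distribution_eq)
  interpret D1: prob_space "distr M borel (z 2)" by (rule prob_space_distr) simp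
  interpret D2: prob_space "distr M borel Q" by (rule prob_space_distr) simp
  interpret P: pair_prob_space "distr M borel (z 2)" "distr M borel Q" ..
  define A where "A = {x :: complex \<times> complex. Im (euler_summand \<sigma> 2 (fst x)) + Im (snd x) = c}"
  have A: "A \<in> sets (borel \<Otimes>\<^sub>M borel)"
  proof -
    have "{x \<in> space (borel \<Otimes>\<^sub>M borel). Im (euler_summand \<sigma> 2 (fst x)) + Im (snd x) = c}
        \<in> sets (borel \<Otimes>\<^sub>M borel)" by measurable
    then show ?thesis by (simp add: A_def space_pair_measure)
  qed
  \<comment> \<open>By independence the joint law is a product measure, so \<open>A\<close> is null
    once its slices are. For a fixed remainder \<open>r\<close> the slice is a level set of the
    argument at the prime 2.\<close>
  have "emeasure (distr M borel (z 2)) ((\<lambda>w. (w, r)) -` A) = 0" for r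
  proof -
    have p2: "real 2 powr - \<sigma> \<le> 1 / 2" by (rule prime_powr_minus_le[OF \<sigma>]) simp
    have "AE w in uniform_circle. Im (Ln (1 - of_real (real 2 powr - \<sigma>) * w)) \<noteq> Im r - c"
      by (rule AE_uniform_circle_Im_Ln_neq) (use p2 in auto)
    then have "AE w in distr M borel (z 2). w \<notin> (\<lambda>w. (w, r)) -` A"
      unfolding distr_z[OF two_is_prime_nat]
      by eventually_elim (auto simp: A_def euler_summand_def)
    moreover have "(\<lambda>w. (w, r)) -` A \<in> sets (distr M borel (z 2))"
      unfolding A_def by simp
    ultimately show ?thesis by (intro null_setsD1) (simp only: AE_iff_null_sets)
  qed
  then have "emeasure (distr M borel (z 2) \<Otimes>\<^sub>M distr M borel Q) A = 0"
    using A by (subst P.emeasure_pair_measure_alt2) auto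
  then have "AE x in distr M (borel \<Otimes>\<^sub>M borel) (\<lambda>\<omega>. (z 2 \<omega>, Q \<omega>)). x \<notin> A"
    using A by (intro AE_I[of _ _ A]) (auto simp: dist)
  then have "AE \<omega> in M. (z 2 \<omega>, Q \<omega>) \<notin> A"
    using A by (subst (asm) AE_distr_iff) (auto simp: A_def)
  with AE_good show ?thesis
  proof eventually_elim
    case (elim \<omega>)
    have "(\<lambda>p. euler_summand \<sigma> p (z p \<omega>)) sums random_log_euler z \<sigma> \<omega>"
      by (rule euler_summand_sums(2)[OF \<sigma>]) (use elim in \<open>auto simp: good_def\<close>)
    moreover have "(\<lambda>p. if p = 2 then euler_summand \<sigma> 2 (z 2 \<omega>) else 0) sums euler_summand \<sigma> 2 (z 2 \<omega>)"
      using sums_single[of 2 "\<lambda>p. euler_summand \<sigma> 2 (z 2 \<omega>)"] by simp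
    ultimately have "(\<lambda>p. euler_summand \<sigma> p (z p \<omega>) - (if p = 2 then euler_summand \<sigma> 2 (z 2 \<omega>) else 0))
        sums (random_log_euler z \<sigma> \<omega> - euler_summand \<sigma> 2 (z 2 \<omega>))"
      by (rule sums_diff)
    moreover have "(\<lambda>p. euler_summand \<sigma> p (z p \<omega>) - (if p = 2 then euler_summand \<sigma> 2 (z 2 \<omega>) else 0)) =
        (\<lambda>p. if p \<in> B then euler_summand \<sigma> p (restrict (\<lambda>i. z i \<omega>) B p) else 0)"
      by (auto simp: B_def euler_summand_def fun_eq_iff)
    ultimately have "Q \<omega> = random_log_euler z \<sigma> \<omega> - euler_summand \<sigma> 2 (z 2 \<omega>)"
      unfolding Q_def R_def by (simp add: sums_iff)
    then show ?case using elim by (auto simp: A_def)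
  qed
qed

lemma AE_Im_random_log_euler_le:
  assumes "\<sigma> > 1"
  shows "AE \<omega> in M. \<bar>Im (random_log_euler z \<sigma> \<omega>)\<bar> \<le> arcsin_prime_sum \<sigma>"
  using AE_good
  by eventually_elim (rule abs_Im_random_log_euler_le[OF assms], auto simp: good_def)

section \<open>Limits of characteristic functions and of the frequency\<close>

lemma Im_random_log_euler_flow_measurable:
  assumes "\<sigma> > 1"
  shows "(\<lambda>t. Im (random_log_euler prime_flow \<sigma> t)) \<in> borel_measurable borel"
  by (intro borel_measurable_continuous_onI continuous_intros continuous_on_random_log_euler_prime_flow assms)

lemma psi_eq: "psi M z \<sigma> x = expectation (\<lambda>\<omega>. iexp (x * Im (random_log_euler z \<sigma> \<omega>)))"
  unfolding psi_def char_def by (subst integral_distr) auto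

lemma mean_char_tendsto:
  assumes \<sigma>: "\<sigma> > 1"
  shows "((\<lambda>T. \<integral>t. iexp (x * Im (random_log_euler prime_flow \<sigma> t)) \<partial>unif_interval T) \<longlongrightarrow> psi M z \<sigma> x) at_top"
  unfolding psi_eq
proof (rule ap_pair_mean_tendsto)
  note ap = ap_pair_random_log_euler[OF \<sigma>]
  \<comment> \<open>Writing \<open>\<i> * x * Im s\<close> as \<open>x / 2 * (s - cnj s)\<close>
    expresses the character by operations under which \<open>ap_pair\<close> is closed.\<close>
  have "ap_pair (\<lambda>t. exp (of_real (x / 2) * (random_log_euler prime_flow \<sigma> t + (- 1) * cnj (random_log_euler prime_flow \<sigma> t))))
     (\<lambda>\<omega>. exp (of_real (x / 2) * (random_log_euler z \<sigma> \<omega> + (- 1) * cnj (random_log_euler z \<sigma> \<omega>))))"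
    by (intro ap_pair_exp ap_pair_mult ap_pair_add ap_pair_cnj ap_pair_const ap)
  moreover have "of_real (x / 2) * (s + (- 1) * cnj s) = \<i> * of_real (x * Im s)" for s
    by (simp add: complex_eq_iff)
  ultimately show "ap_pair (\<lambda>t. iexp (x * Im (random_log_euler prime_flow \<sigma> t)))
      (\<lambda>\<omega>. iexp (x * Im (random_log_euler z \<sigma> \<omega>)))" by (simp only:)
  show "(\<lambda>t. iexp (x * Im (random_log_euler prime_flow \<sigma> t))) \<in> borel_measurable borel"
    using Im_random_log_euler_flow_measurable[OF \<sigma>] by measurable
qed measurable

text \<open>Each mean over a symmetric interval equals its own conjugate, and the real line is
  closed in the complex plane.\<close>

lemma psi_real:
  assumes \<sigma>: "\<sigma> > 1"
  shows "psi M z \<sigma> x \<in> \<real>"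
proof -
  define f where "f t = iexp (x * Im (random_log_euler prime_flow \<sigma> t))" for t
  have [measurable]: "f \<in> borel_measurable borel"
    unfolding f_def using Im_random_log_euler_flow_measurable[OF \<sigma>] by measurable
  have sym: "f (- t) = cnj (f t)" for t
    by (simp add: f_def Im_random_log_euler_minus[OF \<sigma>] exp_cnj)
  have "((\<lambda>T. \<integral>t. f t \<partial>unif_interval T) \<longlongrightarrow> psi M z \<sigma> x) at_top"
    unfolding f_def by (rule mean_char_tendsto[OF \<sigma>])
  moreover have "\<forall>\<^sub>F T in at_top. (\<integral>t. f t \<partial>unif_interval T) \<in> \<real>"
    using eventually_gt_at_top[of 0]
  proof eventually_elim
    case (elim T)
    have "(\<integral>t. indicator {-T..T} t *\<^sub>R f t \<partial>lborel) = (\<integral>t. indicator {-T..T} (- t) *\<^sub>R f (- t) \<partial>lborel)"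
      using lborel_integral_real_affine[of "- 1" "\<lambda>t. indicator {-T..T} t *\<^sub>R f t" 0] by simp
    also have "\<dots> = (\<integral>t. cnj (indicator {-T..T} t *\<^sub>R f t) \<partial>lborel)"
      by (intro Bochner_Integration.integral_cong) (auto simp: sym split: split_indicator)
    also have "\<dots> = cnj (\<integral>t. indicator {-T..T} t *\<^sub>R f t \<partial>lborel)" by (rule Bochner_Integration.integral_cnj)
    finally have "(\<integral>t. indicator {-T..T} t *\<^sub>R f t \<partial>lborel) \<in> \<real>" by (simp add: Reals_cnj_iff)
    then show ?case
      using elim by (subst integral_uniform_measure_lborel) (auto simp: scaleR_conv_of_real)
  qed
  ultimately show ?thesis
    by (intro Lim_in_closed_set[OF closed_complex_Reals]) auto
qed

lemma mean_exceed_tendsto: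
  assumes \<sigma>: "\<sigma> > 1"
  shows "((\<lambda>T. measure (unif_interval T) {t. \<bar>Im (random_log_euler prime_flow \<sigma> t)\<bar> > pi / 2}) \<longlongrightarrow>
    prob {\<omega>\<in>space M. \<bar>Im (random_log_euler z \<sigma> \<omega>)\<bar> > pi / 2}) at_top"
proof (rule tendsto_at_topI_sequentially)
  fix X :: "nat \<Rightarrow> real" assume X: "filterlim X at_top sequentially"
  define \<Theta> where "\<Theta> t = Im (random_log_euler prime_flow \<sigma> t)" for t
  have [measurable]: "\<Theta> \<in> borel_measurable borel"
    unfolding \<Theta>_def by (rule Im_random_log_euler_flow_measurable[OF \<sigma>])
  \<comment> \<open>Early terms of \<open>X\<close> may be nonpositive, where
    \<open>unif_interval\<close> is not a probability measure. The modified sequence agrees with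
    \<open>X\<close> eventually.\<close>
  define T where "T n = max 1 (X n)" for n
  have T: "T n > 0" for n by (simp add: T_def)
  have TX: "\<forall>\<^sub>F n in sequentially. T n = X n"
    using X unfolding filterlim_at_top by (auto simp: T_def dest!: spec[of _ 1] elim!: eventually_mono)
  have Tlim: "filterlim T at_top sequentially"
    using X TX by (subst filterlim_cong[OF refl refl]) auto
  define \<mu> where "\<mu> n = distr (unif_interval (T n)) borel \<Theta>" for n
  define \<nu> where "\<nu> = distr M borel (\<lambda>\<omega>. Im (random_log_euler z \<sigma> \<omega>))"
  define A where "A = {y :: real. \<bar>y\<bar> > pi / 2}"
  have A: "A = - {- (pi / 2)..pi / 2}" by (auto simp: A_def)
  have \<mu>: "real_distribution (\<mu> n)" for n
  proof -
    interpret U: prob_space "unif_interval (T n)" by (rule prob_space_unif_interval[OF T])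
    show ?thesis unfolding \<mu>_def by (rule U.real_distribution_distr) simp
  qed
  have \<nu>: "real_distribution \<nu>"
    unfolding \<nu>_def by (rule real_distribution_distr) simp
  have wc: "weak_conv_m \<mu> \<nu>"
  proof (rule levy_continuity[OF \<mu> \<nu>])
    fix x
    have "char (\<mu> n) x = (\<integral>t. iexp (x * \<Theta> t) \<partial>unif_interval (T n))" for n
      unfolding \<mu>_def char_def by (subst integral_distr) auto
    moreover have "char \<nu> x = psi M z \<sigma> x" by (simp add: \<nu>_def psi_def)
    ultimately show "(\<lambda>n. char (\<mu> n) x) \<longlonglongrightarrow> char \<nu> x"
      using filterlim_compose[OF mean_char_tendsto[OF \<sigma>] Tlim] by (simp add: \<Theta>_def)
  qed
  \<comment> \<open>Weak convergence yields convergence of probabilities for sets whose frontier is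
    null under the limit law. Here the frontier consists of two points, and the absence of atoms
    makes it null.\<close>
  have fr: "frontier A = {- (pi / 2), pi / 2}"
    unfolding A frontier_complement by (auto simp: frontier_def)
  have "AE \<omega> in M. Im (random_log_euler z \<sigma> \<omega>) \<notin> {- (pi / 2), pi / 2}"
    using AE_Im_random_log_euler_neq[OF \<sigma>, of "pi / 2"] AE_Im_random_log_euler_neq[OF \<sigma>, of "- (pi / 2)"]
    by eventually_elim auto
  then have "AE y in \<nu>. y \<notin> frontier A"
    unfolding \<nu>_def fr by (subst AE_distr_iff) auto
  then have "frontier A \<in> null_sets \<nu>"
    by (subst AE_iff_null_sets) (auto simp: \<nu>_def fr)
  then have "emeasure \<nu> (frontier A) = 0" by (rule null_setsD1)
  then have "(\<lambda>n. measure (\<mu> n) A) \<longlonglongrightarrow> measure \<nu> A"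
    by (intro weak_conv_imp_continuity_set_conv[OF \<mu> \<nu> wc]) (auto simp: A)
  moreover have "measure \<nu> A = prob {\<omega>\<in>space M. \<bar>Im (random_log_euler z \<sigma> \<omega>)\<bar> > pi / 2}"
    unfolding \<nu>_def by (subst measure_distr) (auto simp: A_def intro!: arg_cong[where f = prob])
  moreover have "measure (\<mu> n) A = measure (unif_interval (T n)) {t. \<bar>\<Theta> t\<bar> > pi / 2}" for n
    unfolding \<mu>_def by (subst measure_distr) (auto simp: A_def vimage_def)
  ultimately have "(\<lambda>n. measure (unif_interval (T n)) {t. \<bar>\<Theta> t\<bar> > pi / 2})
      \<longlonglongrightarrow> prob {\<omega>\<in>space M. \<bar>Im (random_log_euler z \<sigma> \<omega>)\<bar> > pi / 2}" by simp
  then show "(\<lambda>n. measure (unif_interval (X n)) {t. \<bar>Im (random_log_euler prime_flow \<sigma> t)\<bar> > pi / 2})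
      \<longlonglongrightarrow> prob {\<omega>\<in>space M. \<bar>Im (random_log_euler z \<sigma> \<omega>)\<bar> > pi / 2}"
    by (rule Lim_transform_eventually) (use TX in \<open>auto simp: \<Theta>_def elim!: eventually_mono\<close>)
qed

lemma arg_exceed_freq_tendsto:
  assumes lz: "is_log_zeta log_zeta" and \<sigma>: "\<sigma> > 1"
  shows "(arg_exceed_freq log_zeta \<sigma> \<longlongrightarrow> prob {\<omega>\<in>space M. \<bar>Im (random_log_euler z \<sigma> \<omega>)\<bar> > pi / 2}) at_top"
proof (rule Lim_transform_eventually[OF mean_exceed_tendsto[OF \<sigma>]])
  show "\<forall>\<^sub>F T in at_top. measure (unif_interval T) {t. \<bar>Im (random_log_euler prime_flow \<sigma> t)\<bar> > pi / 2} =
      arg_exceed_freq log_zeta \<sigma> T"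
    using eventually_gt_at_top[of 0]
  proof eventually_elim
    case (elim T)
    define \<Theta> where "\<Theta> t = Im (random_log_euler prime_flow \<sigma> t)" for t
    have [measurable]: "\<Theta> \<in> borel_measurable borel"
      unfolding \<Theta>_def by (rule Im_random_log_euler_flow_measurable[OF \<sigma>])
    have "measure (unif_interval T) {t. \<bar>\<Theta> t\<bar> > pi / 2} =
        measure lborel ({-T..T} \<inter> {t. \<bar>\<Theta> t\<bar> > pi / 2}) / (2 * T)"
      using elim by (subst measure_uniform_measure) auto
    \<comment> \<open>Closed and open intervals differ by two null endpoints; as the set is Borel,
      Lebesgue measure then agrees with \<open>lborel\<close>.\<close>
    also have "measure lborel ({-T..T} \<inter> {t. \<bar>\<Theta> t\<bar> > pi / 2}) = measure lborel {t. \<bar>t\<bar> < T \<and> \<bar>\<Theta> t\<bar> > pi / 2}"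
    proof (rule measure_eq_AE)
      show "AE t in lborel. t \<in> {-T..T} \<inter> {t. \<bar>\<Theta> t\<bar> > pi / 2} \<longleftrightarrow> t \<in> {t. \<bar>t\<bar> < T \<and> \<bar>\<Theta> t\<bar> > pi / 2}"
        using AE_lborel_singleton[of T] AE_lborel_singleton[of "- T"] by eventually_elim auto
    qed measurable
    also have "\<dots> = measure lebesgue {t. \<bar>t\<bar> < T \<and> \<bar>\<Theta> t\<bar> > pi / 2}"
      by (rule measure_completion[symmetric]) measurable
    finally show ?case
      by (simp add: \<Theta>_def arg_exceed_freq_def log_zeta_eq_random_log_euler[OF lz \<sigma>])
  qed
qed

section \<open>Expectation of the Fourier series\<close>

lemma psi_sine_series_sums:
  assumes \<sigma>: "\<sigma> > 1" and l: "l > max (pi / 2) (arcsin_prime_sum \<sigma>)"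
  shows "(\<lambda>n. 1 / of_nat (Suc n) * psi M z \<sigma> (pi * real (Suc n) / l) * of_real (sin (real (Suc n) * pi\<^sup>2 / (2 * l))))
    sums of_real (pi / 2 * (prob {\<omega>\<in>space M. \<bar>Im (random_log_euler z \<sigma> \<omega>)\<bar> \<le> pi / 2} - pi / (2 * l)))"
proof -
  define Y where "Y \<omega> = Im (random_log_euler z \<sigma> \<omega>)" for \<omega>
  have Y[measurable]: "Y \<in> borel_measurable M" unfolding Y_def by measurable
  define b where "b n x = 1 / real (Suc n) * cos (pi * real (Suc n) / l * x) * sin (real (Suc n) * pi\<^sup>2 / (2 * l))"
    for n x
  have [measurable]: "b n \<in> borel_measurable borel" for n unfolding b_def by measurable
  define v where "v \<omega> = pi / 2 * (indicator {\<omega>\<in>space M. \<bar>Y \<omega>\<bar> \<le> pi / 2} \<omega> - pi / (2 * l))" for \<omega>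
  have [measurable]: "v \<in> borel_measurable M" unfolding v_def by measurable
  \<comment> \<open>Outcomes where \<open>Y\<close> hits a jump or exceeds the arcsine bound form a
    null set; otherwise the hypothesis on \<open>l\<close> places \<open>Y\<close> strictly inside
    one period. The constant \<open>pi + 2\<close> is integrable because \<open>M\<close> is a
    probability measure.\<close>
  have lim: "(\<lambda>N. expectation (\<lambda>\<omega>. \<Sum>n<N. b n (Y \<omega>))) \<longlonglongrightarrow> expectation v"
  proof (rule integral_dominated_convergence[where w = "\<lambda>_. pi + 2"])
    show "AE \<omega> in M. (\<lambda>N. \<Sum>n<N. b n (Y \<omega>)) \<longlonglongrightarrow> v \<omega>"
      using AE_Im_random_log_euler_le[OF \<sigma>] AE_Im_random_log_euler_neq[OF \<sigma>, of "pi / 2"]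
        AE_Im_random_log_euler_neq[OF \<sigma>, of "- (pi / 2)"] AE_space
    proof eventually_elim
      case (elim \<omega>)
      have "\<bar>Y \<omega>\<bar> < l" "\<bar>Y \<omega>\<bar> \<noteq> pi / 2" using elim l by (auto simp: Y_def)
      from indicator_fourier_sums[OF _ this] l elim
      show ?case by (simp add: sums_def b_def v_def of_bool_def indicator_def)
    qed
    show "AE \<omega> in M. norm (\<Sum>n<N. b n (Y \<omega>)) \<le> pi + 2" for N
      using indicator_fourier_partial_sums_bounded by (simp add: b_def)
  qed auto
  have bb: "\<bar>b n x\<bar> \<le> 1" for n x
  proof -
    have "\<bar>b n x\<bar> \<le> 1 * 1 * 1" unfolding b_def abs_mult
      by (intro mult_mono) (auto simp: field_simps)
    then show ?thesis by simp
  qed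
  have int: "integrable M (\<lambda>\<omega>. b n (Y \<omega>))" for n
    using bb by (intro integrable_const_bound[where B = 1]) auto
  have "(\<lambda>n. expectation (\<lambda>\<omega>. b n (Y \<omega>))) sums expectation v"
    using lim int by (simp add: sums_def Bochner_Integration.integral_sum)
  moreover have "expectation v = pi / 2 * (prob {\<omega>\<in>space M. \<bar>Y \<omega>\<bar> \<le> pi / 2} - pi / (2 * l))"
  proof -
    have "integrable M (indicator {\<omega>\<in>space M. \<bar>Y \<omega>\<bar> \<le> pi / 2} :: 'a \<Rightarrow> real)"
      by (intro integrable_const_bound[where B = 1]) auto
    then show ?thesis unfolding v_def by (simp add: prob_space)
  qed
  moreover have "of_real (expectation (\<lambda>\<omega>. b n (Y \<omega>))) =
      1 / of_nat (Suc n) * psi M z \<sigma> (pi * real (Suc n) / l) * of_real (sin (real (Suc n) * pi\<^sup>2 / (2 * l)))" for n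
  proof -
    define x where "x = pi * real (Suc n) / l"
    have i: "integrable M (\<lambda>\<omega>. iexp (x * Y \<omega>))"
      by (intro integrable_const_bound[where B = 1]) auto
    \<comment> \<open>The Fourier series involves only cosines; as \<open>psi\<close> is real, it
      equals the expectation of the cosine.\<close>
    have "Re (psi M z \<sigma> x) = expectation (\<lambda>\<omega>. Re (iexp (x * Y \<omega>)))"
      unfolding psi_eq Y_def[symmetric] using i by simp
    also have "\<dots> = expectation (\<lambda>\<omega>. cos (x * Y \<omega>))" by (simp add: Re_exp)
    finally have "psi M z \<sigma> x = of_real (expectation (\<lambda>\<omega>. cos (x * Y \<omega>)))"
      using psi_real[OF \<sigma>, of x] by (metis of_real_Re)
    moreover have "expectation (\<lambda>\<omega>. b n (Y \<omega>)) =
        1 / real (Suc n) * expectation (\<lambda>\<omega>. cos (x * Y \<omega>)) * sin (real (Suc n) * pi\<^sup>2 / (2 * l))"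
      unfolding b_def x_def[symmetric] by simp
    ultimately show ?thesis by (simp add: x_def)
  qed
  ultimately show ?thesis
    unfolding Y_def by (metis (no_types, lifting) sums_of_real sums_cong)
qed

end

theorem theorem5:
  fixes \<sigma> l :: real
    and log_zeta :: "complex \<Rightarrow> complex"
    and M :: "'a measure"
    and z :: "nat \<Rightarrow> 'a \<Rightarrow> complex"
  assumes "is_log_zeta log_zeta"
    and "prob_space M"
    and "prob_space.indep_vars M (\<lambda>_. borel) z {p. prime p}"
    and "\<And>p. prime p \<Longrightarrow> distr M borel (z p) = uniform_circle"
    and "\<sigma> > 1"
    and "l > max (pi / 2) (arcsin_prime_sum \<sigma>)"
  defines "a \<equiv> \<lambda>n::nat. 1 / of_nat n * psi M z \<sigma> (pi * real n / l)
                  * of_real (sin (real n * pi\<^sup>2 / (2 * l)))"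
  shows "(arg_exceed_freq log_zeta \<sigma> \<longlongrightarrow> arg_exceed_density log_zeta \<sigma>) at_top \<and>
         summable (\<lambda>n. a (Suc n)) \<and>
         complex_of_real (arg_exceed_density log_zeta \<sigma>) =
           1 - of_real (pi / (2 * l)) - of_real (2 / pi) * (\<Sum>n. a (Suc n))"
proof -
  interpret random_euler M z
    using assms(2-4) by (simp add: random_euler_def random_euler_axioms_def)
  \<comment> \<open>\<open>q\<close> links the two results: the density is \<open>1 - q\<close>, and
    the sum of the series is affine in \<open>q\<close>.\<close>
  define q where "q = prob {\<omega>\<in>space M. \<bar>Im (random_log_euler z \<sigma> \<omega>)\<bar> \<le> pi / 2}"
  have lim: "(arg_exceed_freq log_zeta \<sigma> \<longlongrightarrow> 1 - q) at_top"
  proof -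
    have "prob {\<omega>\<in>space M. \<not> \<bar>Im (random_log_euler z \<sigma> \<omega>)\<bar> \<le> pi / 2} = 1 - q"
      unfolding q_def by (rule prob_neg) measurable
    then show ?thesis
      using arg_exceed_freq_tendsto[OF assms(1,5)] by (simp add: not_le)
  qed
  then have d: "arg_exceed_density log_zeta \<sigma> = 1 - q"
    unfolding arg_exceed_density_def by (intro tendsto_Lim) auto
  have sums: "(\<lambda>n. a (Suc n)) sums of_real (pi / 2 * (q - pi / (2 * l)))"
    unfolding a_def q_def by (rule psi_sine_series_sums[OF assms(5,6)])
  have "1 - q = 1 - pi / (2 * l) - 2 / pi * (pi / 2 * (q - pi / (2 * l)))"
  proof -
    have "2 / pi * (pi / 2 * x) = x" for x by simp
    then show ?thesis by (simp only:)
  qed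
  then have "complex_of_real (1 - q) =
      1 - of_real (pi / (2 * l)) - of_real (2 / pi) * of_real (pi / 2 * (q - pi / (2 * l)))"
    by (metis of_real_1 of_real_diff of_real_mult)
  then show ?thesis
    using lim sums by (simp only: d sums_iff)
qed

end
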